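(* Let $n\ge1$ and let $B$ be a real $n\times n$ matrix all of whose eigenvalues have negative real parts. There is a positive integer $\bar N$, depending only on $n$ and $B$, such that for every real symmetric positive definite $n\times n$ matrix $Q$ and every $(x,u)\in\mathbb R^n\times\mathbb R^n$, the number of zeros in $(0,1]$ of the function $t\mapsto\dot K_t(x,u)=\partial_tK_t(x,u)$ is at most $\bar N$, where $K_t$ is the Mehler kernel associated with $Q$ and $B$.
   Context: For $t\in(0,+\infty]$ put $Q_t=\int_0^t e^{sB}Qe^{sB^*}\,ds$ (symmetric, positive definite), $R(x)=\frac12\langle Q_\infty^{-1}x,x\rangle$, and $D_t=Q_\infty e^{-tB^*}Q_\infty^{-1}$ for $t\in\mathbb R$. The Mehler kernel is, for $x,u\in\mathbb R^n$ and $t>0$, $$K_t(x,u)=\Big(\frac{\det Q_\infty}{\det Q_t}\Big)^{1/2}e^{R(x)}\exp\Big[-\tfrac12\big\langle (Q_t^{-1}-Q_\infty^{-1})(u-D_tx),u-D_tx\big\rangle\Big].$$ *)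

theory Defs
  imports "HOL-Analysis.Analysis"
begin

text \<open>The multiplication of type \<^typ>\<open>real^'n^'n\<close> is the entrywise one, so \<^const>\<open>exp\<close> is not the
  matrix exponential there; it is defined here by its power series with respect to \<open>(**)\<close>.\<close>

definition matrix_exp :: "real^'n^'n \<Rightarrow> real^'n^'n" where
  "matrix_exp A = (\<Sum>k. (1 / fact k) *\<^sub>R (((**) A) ^^ k) (mat 1))"

definition complex_eigenvalue :: "real^'n^'n \<Rightarrow> complex \<Rightarrow> bool" where
  "complex_eigenvalue A z \<longleftrightarrow>
     (\<exists>v :: complex^'n. v \<noteq> 0 \<and> map_matrix complex_of_real A *v v = z *s v)"

definition sym_pos_def :: "real^'n^'n \<Rightarrow> bool" where
  "sym_pos_def A \<longleftrightarrow> transpose A = A \<and> (\<forall>x. x \<noteq> 0 \<longrightarrow> (A *v x) \<bullet> x > 0)"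

text \<open>The extended real \<open>t\<close> covers both \<open>Q\<^sub>t\<close> (integral over \<open>{0..t}\<close>) and \<open>Q\<^sub>\<infinity>\<close>
  (integral over \<open>{0..}\<close>); \<open>B\<^sup>*\<close> is the transpose of \<open>B\<close>.\<close>

definition Qcov :: "real^'n^'n \<Rightarrow> real^'n^'n \<Rightarrow> ereal \<Rightarrow> real^'n^'n" where
  "Qcov B Q t = integral {s. 0 \<le> s \<and> ereal s \<le> t}
     (\<lambda>s. matrix_exp (s *\<^sub>R B) ** Q ** matrix_exp (s *\<^sub>R transpose B))"

definition Rquad :: "real^'n^'n \<Rightarrow> real^'n^'n \<Rightarrow> real^'n \<Rightarrow> real" where
  "Rquad B Q x = 1/2 * ((matrix_inv (Qcov B Q \<infinity>) *v x) \<bullet> x)"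

definition Dmat :: "real^'n^'n \<Rightarrow> real^'n^'n \<Rightarrow> real \<Rightarrow> real^'n^'n" where
  "Dmat B Q t =
     Qcov B Q \<infinity> ** matrix_exp ((- t) *\<^sub>R transpose B) ** matrix_inv (Qcov B Q \<infinity>)"

definition mehler_kernel ::
    "real^'n^'n \<Rightarrow> real^'n^'n \<Rightarrow> real \<Rightarrow> real^'n \<Rightarrow> real^'n \<Rightarrow> real" where
  "mehler_kernel B Q t x u =
     sqrt (det (Qcov B Q \<infinity>) / det (Qcov B Q (ereal t))) * exp (Rquad B Q x) *
     exp (- (1/2) *
       (((matrix_inv (Qcov B Q (ereal t)) - matrix_inv (Qcov B Q \<infinity>)) *v (u - Dmat B Q t *v x))
          \<bullet> (u - Dmat B Q t *v x)))"

end

theory Submission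
  imports Defs "HOL-Library.Function_Algebras" "HOL-Library.Set_Algebras"
    "HOL-Computational_Algebra.Fundamental_Theorem_Algebra"
begin

text \<open>Up to a positive constant \<open>K\<^sub>t\<close> equals \<open>exp (- \<phi> t / 2)\<close> with \<open>\<phi> = ln d + n / d\<close>, where
  \<open>d = det Q\<^sub>t\<close> and, by Cramer's rule, \<open>n\<close> is a polynomial in the entries of \<open>Q\<^sub>t\<close> and of
  \<open>exp (- t B\<^sup>*)\<close>. Hence the zeros of the derivative of \<open>K\<^sub>t\<close> are those of
  \<open>f = d d' + n' d - n d'\<close>, which lies in a finite-dimensional space of functions that is closed under
  differentiation and depends on \<open>B\<close> only. All elements of such a space solve one linear differential
  equation with constant coefficients, so on intervals of a fixed short length a nonzero element has
  fewer zeros than the order of the equation. Finally \<open>f\<close> is not identically zero, because otherwise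
  \<open>K\<^sub>t\<close> would be constant, contradicting its behaviour as \<open>t\<close> tends to \<open>0\<close>.\<close>

section \<open>Spans of functions and zeros of solutions of linear differential equations\<close>

text \<open>The bound is uniform in \<open>Q\<close> because \<open>Q\<close> enters the entries of
  the finite-time covariance linearly, as real coefficients in front of functions determined by
  \<open>B\<close>, while the covariance at infinity and its inverse enter the exponent only as
  constant matrices. Thus \<open>Q\<close>, \<open>x\<close> and \<open>u\<close> select an element
  of the function space but never change the space. The eigenvalues of \<open>B\<close> may be
  nonreal, so these functions can oscillate, and the order of the equation alone cannot bound their
  zeros on [0,1]. The length of the short intervals comes from the size of the coefficients of the
  equation, and the number of such intervals enters the bound. Stability of \<open>B\<close> gives
  the covariance at infinity its meaning; the exponential decay of the matrix exponential is derived
  for this purpose.\<close>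

lemma (in vector_space) exists_in_span_of_previous:
  fixes x :: "nat \<Rightarrow> 'b"
  assumes "finite T" and "\<And>j. x j \<in> span T"
  shows "\<exists>m. x m \<in> span (x ` {..<m})"
proof (rule ccontr)
  assume "\<not> ?thesis"
  then have no: "x m \<notin> span (x ` {..<m})" for m by blast
  have ind: "independent (x ` {..<m}) \<and> card (x ` {..<m}) = m" for m
  proof (induction m)
    case 0
    show ?case by (simp add: independent_empty)
  next
    case (Suc m)
    have "x m \<notin> x ` {..<m}" using no[of m] span_base[of "x m" "x ` {..<m}"] by auto
    moreover have "x ` {..<Suc m} = insert (x m) (x ` {..<m})" by (auto simp: less_Suc_eq)
    ultimately show ?case
      using Suc independent_insertI[OF no[of m]] by (metis card_insert_disjoint finite_imageI finite_lessThan)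
  qed
  have "x ` {..<Suc (card T)} \<subseteq> span T" using assms(2) by auto
  from independent_span_bound[OF assms(1) _ this] ind[of "Suc (card T)"]
  show False by (metis Suc_n_not_le_n)
qed

text \<open>The sum runs over indices, so repetitions among the \<open>x j\<close> do no harm. With
  the preceding lemma it yields a relation with leading coefficient 1, below once for iterated
  derivatives and once for matrix powers.\<close>

lemma (in vector_space) span_image_lessThan:
  fixes x :: "nat \<Rightarrow> 'b"
  assumes "y \<in> span (x ` {..<m})"
  shows "\<exists>a. y = (\<Sum>j<m. scale (a j) (x j))"
  using assms
proof (induction rule: span_induct_alt)
  case base
  show ?case by (rule exI[of _ "\<lambda>_. 0"]) simp
next
  case (step c u v)
  then obtain k a where "k < m" "u = x k" "v = (\<Sum>j<m. scale (a j) (x j))" by auto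
  moreover have "(\<Sum>j<m. scale ((a(k := a k + c)) j) (x j))
      = (\<Sum>j<m. scale (a j) (x j) + (if j = k then scale c (x k) else 0))"
    by (intro sum.cong) (auto simp: scale_left_distrib)
  ultimately have "scale c u + v = (\<Sum>j<m. scale ((a(k := a k + c)) j) (x j))"
    by (simp add: sum.distrib)
  then show ?case by blast
qed

interpretation fs: vector_space "\<lambda>(c::real) (f::'a \<Rightarrow> real) x. c * f x"
  by unfold_locales (auto simp: fun_eq_iff algebra_simps)

text \<open>A finite set with this property encodes a finite-dimensional space of functions
  invariant under d/dt. Working with generators turns products of such spaces into plain set
  products.\<close>

definition deriv_closed :: "(real \<Rightarrow> real) set \<Rightarrow> bool" where
  "deriv_closed S \<longleftrightarrow> (\<forall>g\<in>S. \<exists>h\<in>fs.span S. \<forall>t. (g has_real_derivative h t) (at t))"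

lemma span_deriv_closed:
  assumes "deriv_closed S" "f \<in> fs.span S"
  shows "\<exists>h\<in>fs.span S. \<forall>t. (f has_real_derivative h t) (at t)"
  using assms(2)
proof (induction rule: fs.span_induct_alt)
  case base
  show ?case by (intro bexI[of _ 0] fs.span_zero) (simp add: zero_fun_def)
next
  case (step c u v)
  from step obtain h where h: "h \<in> fs.span S" "\<And>t. (v has_real_derivative h t) (at t)" by blast
  from assms(1) step obtain k where k: "k \<in> fs.span S" "\<And>t. (u has_real_derivative k t) (at t)"
    unfolding deriv_closed_def by blast
  have "((\<lambda>x. c * k x) + h) \<in> fs.span S"
    using fs.span_add[OF fs.span_scale[OF k(1)] h(1)] .
  moreover have "(((\<lambda>x. c * u x) + v) has_real_derivative ((\<lambda>x. c * k x) + h) t) (at t)" for t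
    using h(2)[of t] k(2)[of t] unfolding plus_fun_def by (auto intro!: derivative_eq_intros)
  ultimately show ?case by blast
qed

lemma span_deriv:
  assumes "deriv_closed S" "f \<in> fs.span S"
  shows "deriv f \<in> fs.span S" "(f has_real_derivative deriv f t) (at t)"
proof -
  obtain h where h: "h \<in> fs.span S" "\<And>t. (f has_real_derivative h t) (at t)"
    using span_deriv_closed[OF assms] by blast
  then have "deriv f = h" using DERIV_imp_deriv by blast
  then show "deriv f \<in> fs.span S" "(f has_real_derivative deriv f t) (at t)" using h by auto
qed

lemma span_higher_deriv:
  assumes "deriv_closed S" "f \<in> fs.span S"
  shows "(deriv ^^ j) f \<in> fs.span S"
  using span_deriv(1)[OF assms(1)] assms(2) by (induction j) simp_all

lemma span_mult:
  assumes "f \<in> fs.span S" "g \<in> fs.span T"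
  shows "f * g \<in> fs.span (S * T)"
  using assms(1)
proof (induction rule: fs.span_induct_alt)
  case base
  then show ?case unfolding mult_zero_left by (rule fs.span_zero)
next
  case (step c u v)
  have "u * g \<in> fs.span (S * T)"
    using assms(2)
  proof (induction rule: fs.span_induct_alt)
    case base
    then show ?case unfolding mult_zero_right by (rule fs.span_zero)
  next
    case (step d p q)
    have "u * ((\<lambda>x. d * p x) + q) = (\<lambda>x. d * (u * p) x) + u * q"
      by (auto simp: fun_eq_iff algebra_simps)
    then show ?case
      using fs.span_add[OF fs.span_scale[OF fs.span_base[OF set_times_intro[OF \<open>u \<in> S\<close> step(1)]]] step(2)]
      by (simp only:)
  qed
  moreover have "((\<lambda>x. c * u x) + v) * g = (\<lambda>x. c * (u * g) x) + v * g"
    by (auto simp: fun_eq_iff algebra_simps)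
  ultimately show ?case
    using fs.span_add[OF fs.span_scale step(2)] by (simp only:)
qed

lemma deriv_closed_mult:
  assumes "deriv_closed S" "deriv_closed T"
  shows "deriv_closed (S * T)"
  unfolding deriv_closed_def
proof
  fix g assume "g \<in> S * T"
  then obtain a b where ab: "g = a * b" "a \<in> S" "b \<in> T" by (auto simp: set_times_def)
  then have sp: "a \<in> fs.span S" "b \<in> fs.span T" by (auto intro: fs.span_base)
  have "deriv a * b + a * deriv b \<in> fs.span (S * T)"
    by (intro fs.span_add span_mult sp span_deriv assms)
  moreover have "(g has_real_derivative (deriv a * b + a * deriv b) t) (at t)" for t
    unfolding ab(1) times_fun_def plus_fun_def
    using span_deriv(2)[OF assms(1) sp(1), of t] span_deriv(2)[OF assms(2) sp(2), of t]
    by (auto intro!: derivative_eq_intros)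
  ultimately show "\<exists>h\<in>fs.span (S * T). \<forall>t. (g has_real_derivative h t) (at t)" by blast
qed

lemma deriv_closed_power: "deriv_closed S \<Longrightarrow> deriv_closed (S ^ k)"
proof (induction k)
  case 0
  have "(1 has_real_derivative (0::real\<Rightarrow>real) t) (at t)" for t::real
    unfolding one_fun_def zero_fun_def by simp
  then show ?case by (auto simp: deriv_closed_def intro!: bexI[of _ 0] fs.span_zero)
qed (simp add: deriv_closed_mult)

lemma finite_power_set: "finite S \<Longrightarrow> finite (S ^ k)"
  for S :: "'a::comm_monoid_mult set"
  by (induction k) (auto intro: finite_set_times)

text \<open>Products with fewer factors are padded by ones, so a single power of the generators can
  hold polynomials of mixed degrees.\<close>

lemma power_set_mono:
  fixes S :: "'a::comm_monoid_mult set"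
  assumes "1 \<in> S" "a \<le> b"
  shows "S ^ a \<subseteq> S ^ b"
  using assms(2)
proof (induction rule: dec_induct)
  case (step n)
  have "S ^ n \<subseteq> S * S ^ n"
    using assms(1) set_times_intro[of 1 S _ "S ^ n"] by auto
  then show ?case using step by simp
qed simp

text \<open>The coefficients must be common to all \<open>f\<close>. Therefore
  \<open>\<Phi> j\<close> bundles the j-th derivatives of all generators into one function on pairs,
  and \<open>\<psi> g0 h\<close> puts \<open>h\<close> into the block of \<open>g0\<close>. The
  finitely many blocks in \<open>T\<close> span every \<open>\<Phi> j\<close>, so one linear
  dependence among the \<open>\<Phi> j\<close> serves all generators at once.\<close>

lemma span_higher_deriv_relation:
  assumes "finite S" "deriv_closed S"
  shows "\<exists>m a. \<forall>f\<in>fs.span S. \<forall>t. (deriv ^^ m) f t = (\<Sum>j<m. a j * (deriv ^^ j) f t)"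
proof -
  define \<Phi> :: "nat \<Rightarrow> (real \<Rightarrow> real) \<times> real \<Rightarrow> real"
    where "\<Phi> j = (\<lambda>(g, t). if g \<in> S then (deriv ^^ j) g t else 0)" for j
  define \<psi> :: "(real \<Rightarrow> real) \<Rightarrow> (real \<Rightarrow> real) \<Rightarrow> (real \<Rightarrow> real) \<times> real \<Rightarrow> real"
    where "\<psi> g0 h = (\<lambda>(g, t). if g = g0 then h t else 0)" for g0 h
  define T where "T = (\<lambda>(g, h). \<psi> g h) ` (S \<times> S)"
  have \<psi>: "\<psi> g h \<in> fs.span T" if "g \<in> S" "h \<in> fs.span S" for g h
    using that(2)
  proof (induction rule: fs.span_induct_alt)
    case base
    have "\<psi> g 0 = 0" by (auto simp: \<psi>_def fun_eq_iff)
    then show ?case by (simp only: fs.span_zero)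
  next
    case (step c u v)
    have "\<psi> g ((\<lambda>x. c * u x) + v) = (\<lambda>x. c * \<psi> g u x) + \<psi> g v"
      by (auto simp: \<psi>_def fun_eq_iff)
    moreover have "\<psi> g u \<in> fs.span T" using that(1) step by (auto simp: T_def intro!: fs.span_base)
    ultimately show ?case using fs.span_add[OF fs.span_scale step(2)] by (simp only:)
  qed
  have "\<Phi> j = (\<Sum>g\<in>S. \<psi> g ((deriv ^^ j) g))" for j
  proof -
    have "(\<Sum>g\<in>S. \<psi> g (h g)) (g0, t) = (\<Sum>g\<in>S. \<psi> g (h g) (g0, t))" for h g0 t
      using assms(1) by (induction S rule: finite_induct) auto
    moreover have "(\<Sum>g\<in>S. \<psi> g ((deriv ^^ j) g) (g0, t)) = \<Phi> j (g0, t)" for g0 t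
      using assms(1) by (simp add: \<Phi>_def \<psi>_def)
    ultimately show ?thesis by (auto simp: fun_eq_iff[of "\<Phi> j"])
  qed
  then have "\<Phi> j \<in> fs.span T" for j
    using assms by (auto intro!: fs.span_sum \<psi> span_higher_deriv intro: fs.span_base)
  moreover have "finite T" using assms(1) by (simp add: T_def)
  ultimately obtain m where "\<Phi> m \<in> fs.span (\<Phi> ` {..<m})"
    using fs.exists_in_span_of_previous by blast
  then obtain a where a: "\<Phi> m = (\<Sum>j<m. (\<lambda>x. a j * \<Phi> j x))"
    using fs.span_image_lessThan by blast
  have sum_app: "(\<Sum>j<k. (\<lambda>x. a j * \<Phi> j x)) y = (\<Sum>j<k. a j * \<Phi> j y)" for y k
    by (induction k) auto
  have gen: "(deriv ^^ m) g t = (\<Sum>j<m. a j * (deriv ^^ j) g t)" if "g \<in> S" for g t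
    using fun_cong[OF a, of "(g, t)"] that unfolding sum_app by (simp add: \<Phi>_def)
  \<comment> \<open>\<open>deriv\<close> is additive only for differentiable functions, hence the
    restriction to the span.\<close>
  have add: "(deriv ^^ j) ((\<lambda>x. c * u x) + v) = (\<lambda>x. c * (deriv ^^ j) u x) + (deriv ^^ j) v"
    if "u \<in> fs.span S" "v \<in> fs.span S" for u v j c
  proof (induction j)
    case (Suc j)
    have "deriv ((\<lambda>x. c * (deriv ^^ j) u x) + (deriv ^^ j) v) t
       = c * deriv ((deriv ^^ j) u) t + deriv ((deriv ^^ j) v) t" for t
      unfolding plus_fun_def
      using span_deriv(2)[OF assms(2) span_higher_deriv[OF assms(2) that(1)], of j t]
        span_deriv(2)[OF assms(2) span_higher_deriv[OF assms(2) that(2)], of j t]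
      by (auto intro!: DERIV_imp_deriv derivative_eq_intros)
    then show ?case unfolding funpow.simps o_def Suc by (simp add: fun_eq_iff)
  qed simp
  have zero: "(deriv ^^ j) (0::real\<Rightarrow>real) = 0" for j
    by (induction j) (auto simp: zero_fun_def)
  have "\<forall>t. (deriv ^^ m) f t = (\<Sum>j<m. a j * (deriv ^^ j) f t)" if "f \<in> fs.span S" for f
  proof -
    \<comment> \<open>Membership is carried through the induction because \<open>add\<close>
      requires it of the tail \<open>v\<close>.\<close>
    have "f \<in> fs.span S \<and> (\<forall>t. (deriv ^^ m) f t = (\<Sum>j<m. a j * (deriv ^^ j) f t))"
      using that
    proof (induction rule: fs.span_induct_alt)
      case base
      show ?case unfolding zero by (intro conjI allI fs.span_zero) simp
    next
      case (step c u v)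
      then have u: "u \<in> fs.span S" and v: "v \<in> fs.span S" by (auto intro: fs.span_base)
      then have "(\<lambda>x. c * u x) + v \<in> fs.span S" by (intro fs.span_add fs.span_scale)
      moreover have "(deriv ^^ m) v t = (\<Sum>j<m. a j * (deriv ^^ j) v t)" for t
        using step by blast
      ultimately show ?case unfolding add[OF u v] unfolding plus_fun_apply gen[OF step(1)]
        by (simp add: sum.distrib sum_distrib_left distrib_left mult.left_commute)
    qed
    then show ?thesis ..
  qed
  then show ?thesis by blast
qed

section \<open>Counting zeros with Rolle's theorem\<close>

text \<open>Localising the new zeros between \<open>Min Z\<close> and \<open>Max Z\<close> drives
  the induction: when a new maximum \<open>b\<close> is added, Rolle gives a zero strictly beyond
  \<open>Max A\<close>, hence different from all those found before.\<close>

lemma rolle_card: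
  fixes f f' :: "real \<Rightarrow> real"
  assumes d: "\<And>t. (f has_real_derivative f' t) (at t)"
    and "finite Z" "Z \<noteq> {}" "\<And>z. z \<in> Z \<Longrightarrow> f z = 0"
  shows "\<exists>Z'\<subseteq>{Min Z..Max Z}. finite Z' \<and> Suc (card Z') = card Z \<and> (\<forall>z\<in>Z'. f' z = 0)"
  using assms(2-)
proof (induction rule: finite_linorder_max_induct)
  case (insert b A)
  show ?case
  proof (cases "A = {}")
    case False
    with insert obtain Z' where Z': "Z' \<subseteq> {Min A..Max A}" "finite Z'" "Suc (card Z') = card A"
      "\<forall>z\<in>Z'. f' z = 0" by auto
    have lt: "Max A < b" using insert False by simp
    have "f (Max A) = f b" using insert False by simp
    have "continuous_on {Max A..b} f"
      using d by (intro continuous_at_imp_continuous_on) (auto intro: DERIV_isCont)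
    moreover have "f differentiable (at x)" for x
      using d real_differentiable_def by blast
    ultimately obtain c where c: "Max A < c" "c < b" "(f has_real_derivative 0) (at c)"
      using Rolle[OF lt \<open>f (Max A) = f b\<close>] by blast
    then have "f' c = 0" using d DERIV_unique by blast
    have "Min A \<le> Max A" using insert False by simp
    moreover have "Max (insert b A) = b" "Min (insert b A) = Min A"
      using insert lt False \<open>Min A \<le> Max A\<close>
      by (simp_all add: max_absorb1 min_absorb2)
    moreover have "c \<notin> Z'" using Z' c by auto
    moreover have "b \<notin> A" using insert by auto
    ultimately have "insert c Z' \<subseteq> {Min (insert b A)..Max (insert b A)} \<and> finite (insert c Z') \<and>
       Suc (card (insert c Z')) = card (insert b A) \<and> (\<forall>z\<in>insert c Z'. f' z = 0)"
      using Z' c lt insert \<open>Min A \<le> Max A\<close> \<open>f' c = 0\<close> by fastforce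
    then show ?thesis by blast
  qed (auto intro!: exI[of _ "{}"])
qed simp

text \<open>Each differentiation costs one zero, so after \<open>j\<close> of them at least
  \<open>card Z - j\<close> are left.\<close>

lemma higher_deriv_zeros:
  fixes F :: "nat \<Rightarrow> real \<Rightarrow> real"
  assumes d: "\<And>j t. (F j has_real_derivative F (Suc j) t) (at t)"
    and "finite Z" "Z \<subseteq> {p..q}" "\<And>z. z \<in> Z \<Longrightarrow> F 0 z = 0" "j < card Z"
  shows "\<exists>z\<in>{p..q}. F j z = 0"
proof -
  have "\<exists>Z'\<subseteq>{p..q}. finite Z' \<and> card Z' + j = card Z \<and> (\<forall>z\<in>Z'. F j z = 0)"
    using assms(5)
  proof (induction j)
    case 0
    then show ?case using assms by auto
  next
    case (Suc j)
    then obtain Z' where Z': "Z' \<subseteq> {p..q}" "finite Z'" "card Z' + j = card Z" "\<And>z. z\<in>Z' \<Longrightarrow> F j z = 0"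
      by auto
    then have "Z' \<noteq> {}" using Suc.prems by auto
    then have sub: "{Min Z'..Max Z'} \<subseteq> {p..q}" using Z' Min_in[of Z'] Max_in[of Z'] by auto
    obtain Y where "Y \<subseteq> {Min Z'..Max Z'}" "finite Y" "Suc (card Y) = card Z'" "\<forall>z\<in>Y. F (Suc j) z = 0"
      using rolle_card[OF d Z'(2) \<open>Z' \<noteq> {}\<close> Z'(4)] by auto
    then show ?case using sub Z'(3) by (intro exI[of _ Y]) auto
  qed
  then obtain Z' where "Z' \<subseteq> {p..q}" "finite Z'" "card Z' + j = card Z" "\<forall>z\<in>Z'. F j z = 0" by blast
  moreover from this have "Z' \<noteq> {}" using assms(5) by auto
  ultimately show ?thesis by blast
qed

section \<open>Solutions of a linear differential equation on intervals of a short length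
  \<open>L\<close>\<close>

context
  fixes F :: "nat \<Rightarrow> real \<Rightarrow> real" and m :: nat and a :: "nat \<Rightarrow> real" and L :: real
  assumes d: "\<And>j t. (F j has_real_derivative F (Suc j) t) (at t)"
    and ode: "\<And>t. F m t = (\<Sum>j<m. a j * F j t)"
    and L: "0 < L" "L \<le> 1" "L * (\<Sum>j<m. \<bar>a j\<bar>) < 1"
begin

text \<open>Starting from its zero, each \<open>F j\<close> is at most \<open>L\<close> times the
  supremum of the next derivative. Going down from \<open>F m\<close>, whose supremum is
  \<open>M\<close>, all lower derivatives are at most \<open>L * M\<close>; since
  \<open>L \<le> 1\<close>, one factor \<open>L\<close> may be kept and the others dropped. The
  equation then bounds \<open>M\<close> by a multiple of itself with factor below 1, so
  \<open>M = 0\<close>.\<close>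

lemma ode_solution_vanishes_on_short_interval:
  assumes z: "\<And>j. j < m \<Longrightarrow> \<exists>z\<in>{p..p+L}. F j z = 0" and "j \<le> m" "t \<in> {p..p+L}"
  shows "F j t = 0"
proof -
  have "continuous_on {p..p+L} (\<lambda>x. \<bar>F m x\<bar>)"
    using d by (intro continuous_on_rabs continuous_at_imp_continuous_on) (auto intro: DERIV_isCont)
  then obtain s where s: "s \<in> {p..p+L}" "\<And>x. x \<in> {p..p+L} \<Longrightarrow> \<bar>F m x\<bar> \<le> \<bar>F m s\<bar>"
    using continuous_attains_sup[of "{p..p+L}" "\<lambda>x. \<bar>F m x\<bar>"] L by auto
  define M where "M = \<bar>F m s\<bar>"
  have M0: "M \<ge> 0" by (simp add: M_def)
  have step: "\<bar>F j x\<bar> \<le> L * K" if "j < m" "x \<in> {p..p+L}" "\<And>y. y \<in> {p..p+L} \<Longrightarrow> \<bar>F (Suc j) y\<bar> \<le> K" for j x K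
  proof -
    have "\<exists>z\<in>{p..p+L}. F j z = 0" using z[OF that(1)] .
    then obtain z where z: "z \<in> {p..p+L}" "F j z = 0" by blast
    have "norm (F j x - F j z) \<le> K * norm (x - z)"
      using that z
      by (intro field_differentiable_bound[where S="{p..p+L}" and f'="F (Suc j)"])
         (auto intro: d has_field_derivative_at_within)
    also have "\<dots> \<le> K * L"
      using z that(2) that(3)[OF that(2)] by (intro mult_left_mono) auto
    finally show ?thesis using z by (simp add: mult.commute)
  qed
  have bound: "\<bar>F (m - i) x\<bar> \<le> M \<and> (i > 0 \<longrightarrow> \<bar>F (m - i) x\<bar> \<le> L * M)" if "i \<le> m" "x \<in> {p..p+L}" for i x
    using that
  proof (induction i arbitrary: x)
    case (Suc i)
    then have "\<bar>F (m - Suc i) x\<bar> \<le> L * M"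
      by (intro step) (auto simp: Suc_diff_Suc)
    moreover have "L * M \<le> M" using L M0 mult_right_mono[of L 1 M] by simp
    ultimately show ?case by simp
  qed (use s M_def in auto)
  have lowb: "\<bar>F j x\<bar> \<le> L * M" if "j < m" "x \<in> {p..p+L}" for j x
    using bound[of "m - j" x] that by simp
  have "M \<le> (\<Sum>j<m. \<bar>a j * F j s\<bar>)" unfolding M_def ode by (rule sum_abs)
  also have "\<dots> \<le> (\<Sum>j<m. \<bar>a j\<bar> * (L * M))"
    using lowb s(1) by (intro sum_mono) (auto simp: abs_mult intro!: mult_left_mono)
  also have "\<dots> = L * (\<Sum>j<m. \<bar>a j\<bar>) * M" by (simp add: sum_distrib_right sum_distrib_left ac_simps)
  finally have "M * (1 - L * (\<Sum>j<m. \<bar>a j\<bar>)) \<le> 0" by (simp add: algebra_simps)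
  then have "M = 0" using L(3) M0
    by (metis diff_gt_0_iff_gt linorder_not_less mult_pos_pos order_le_less)
  then show ?thesis using bound[of "m - j" t] assms by simp
qed

text \<open>At the common endpoint of two neighbouring intervals all derivatives already vanish, so
  the previous lemma applies to the next interval; this covers the line in both directions.\<close>

lemma ode_solution_vanishes:
  assumes z: "\<And>j. j < m \<Longrightarrow> \<exists>z\<in>{p..p+L}. F j z = 0"
  shows "F 0 t = 0"
proof -
  have right: "\<forall>j\<le>m. \<forall>t\<in>{p + real k * L..p + real k * L + L}. F j t = 0" for k
  proof (induction k)
    case 0
    then show ?case using ode_solution_vanishes_on_short_interval[of p] z by simp
  next
    case (Suc k)
    have "F j (p + real (Suc k) * L) = 0" if "j < m" for j
      using Suc that L by (auto simp: algebra_simps)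
    then show ?case using L
      by (intro allI impI ballI ode_solution_vanishes_on_short_interval) (auto intro!: bexI)
  qed
  have left: "\<forall>j\<le>m. \<forall>t\<in>{p - real k * L..p - real k * L + L}. F j t = 0" for k
  proof (induction k)
    case 0
    then show ?case using ode_solution_vanishes_on_short_interval[of p] z by simp
  next
    case (Suc k)
    have "F j (p - real k * L) = 0" if "j < m" for j
      using Suc that L by (auto simp: algebra_simps)
    then show ?case using L
      by (intro allI impI ballI ode_solution_vanishes_on_short_interval)
         (auto intro!: bexI[of _ "p - real k * L"] simp: algebra_simps)
  qed
  show ?thesis
  proof (cases "t \<ge> p")
    case True
    define k where "k = nat \<lfloor>(t - p) / L\<rfloor>"
    have "real k \<le> (t - p) / L" "(t - p) / L \<le> real k + 1"
      using True L by (auto simp: k_def)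
    then have "t \<in> {p + real k * L..p + real k * L + L}"
      using L by (auto simp: field_simps)
    then show ?thesis using right[of k] by blast
  next
    case False
    define k where "k = nat \<lceil>(p - t) / L\<rceil>"
    have "(p - t) / L \<ge> 0" using False L by simp
    then have "real k - 1 \<le> (p - t) / L" "(p - t) / L \<le> real k"
      unfolding k_def by linarith+
    then have "t \<in> {p - real k * L..p - real k * L + L}"
      using L by (auto simp: field_simps)
    then show ?thesis using left[of k] by blast
  qed
qed

lemma ode_solution_few_zeros_on_short_interval:
  assumes "F 0 t \<noteq> 0"
  shows "finite {z\<in>{p..p+L}. F 0 z = 0} \<and> card {z\<in>{p..p+L}. F 0 z = 0} \<le> m"
proof (rule ccontr)
  assume "\<not> ?thesis"
  \<comment> \<open>Infinitely many zeros and more than \<open>m\<close> zeros are treated alike: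
    either way there are \<open>m\<close> of them, which by Rolle give a zero of every
    \<open>F j\<close> with \<open>j < m\<close>.\<close>
  then obtain Z where Z: "Z \<subseteq> {z\<in>{p..p+L}. F 0 z = 0}" "finite Z" "card Z = m"
    by (metis (no_types, lifting) infinite_arbitrarily_large linorder_le_cases obtain_subset_with_card_n)
  have "\<exists>z\<in>{p..p+L}. F j z = 0" if "j < m" for j
    using Z that by (intro higher_deriv_zeros[of F, OF d Z(2)]) auto
  then show False using ode_solution_vanishes assms by blast
qed

end

text \<open>Since all functions in the span solve one common linear differential equation, Rolle's
  theorem bounds the number of zeros on short intervals whose length depends only on \<open>S\<close>.\<close>

theorem span_zeros_uniformly_bounded:
  assumes "finite S" "deriv_closed S"
  shows "\<exists>N. \<forall>f\<in>fs.span S. \<forall>t. f t \<noteq> 0 \<longrightarrow>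
    finite {z\<in>{0..1}. f z = 0} \<and> card {z\<in>{0..1}. f z = 0} \<le> N"
proof -
  obtain m a where ode: "\<And>f t. f\<in>fs.span S \<Longrightarrow> (deriv ^^ m) f t = (\<Sum>j<m. a j * (deriv ^^ j) f t)"
    using span_higher_deriv_relation[OF assms] by blast
  \<comment> \<open>An integer, so that [0,1] is cut into \<open>k\<close> pieces of length
    \<open>1 / k\<close>. It depends on the common coefficients only, not on
    \<open>f\<close>.\<close>
  obtain k :: nat where k: "real k > (\<Sum>j<m. \<bar>a j\<bar>)" using reals_Archimedean2 by blast
  moreover have "(\<Sum>j<m. \<bar>a j\<bar>) \<ge> 0" by (simp add: sum_nonneg)
  ultimately have k0: "k > 0" by (metis not_gr0 of_nat_0 linorder_not_less)
  have L: "0 < 1 / real k" "1 / real k \<le> 1" "1 / real k * (\<Sum>j<m. \<bar>a j\<bar>) < 1"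
    using k k0 by (auto simp: field_simps)
  have "finite {z\<in>{0..1}. f z = 0} \<and> card {z\<in>{0..1}. f z = 0} \<le> k * m"
    if f: "f \<in> fs.span S" "f t \<noteq> 0" for f t
  proof -
    define Z where "Z i = {z\<in>{real i / real k..real i / real k + 1 / real k}. f z = 0}" for i
    have Z: "finite (Z i) \<and> card (Z i) \<le> m" for i
      unfolding Z_def
      using ode_solution_few_zeros_on_short_interval[of "\<lambda>j. (deriv ^^ j) f", OF _ ode[OF f(1)] L, of t] f
        span_deriv(2)[OF assms(2) span_higher_deriv[OF assms(2) f(1)]] by auto
    have sub: "{z\<in>{0..1}. f z = 0} \<subseteq> (\<Union>i<k. Z i)"
    proof
      fix z assume z: "z \<in> {z\<in>{0..1}. f z = 0}"
      show "z \<in> (\<Union>i<k. Z i)"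
      \<comment> \<open>At \<open>z = 1\<close> the floor used in the other case would give
        \<open>i = k\<close>, one past the last piece.\<close>
      proof (cases "z = 1")
        case True
        then have "z \<in> Z (k - 1)" using z k0 by (auto simp: Z_def field_simps of_nat_diff)
        then show ?thesis using k0 by (intro UN_I[of "k - 1"]) auto
      next
        case False
        define i where "i = nat \<lfloor>z * k\<rfloor>"
        have i: "real i \<le> z * k" "z * k < real i + 1" using z by (auto simp: i_def)
        moreover have "z * k < k" using z False k0 by auto
        ultimately have "i < k" by simp
        moreover have "z \<in> Z i" using i z k0 by (auto simp: Z_def field_simps)
        ultimately show ?thesis by blast
      qed
    qed
    have fin: "finite (\<Union>i<k. Z i)" using Z by blast
    have "card (\<Union>i<k. Z i) \<le> (\<Sum>i<k. card (Z i))" by (rule card_UN_le) simp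
    also have "\<dots> \<le> (\<Sum>i<k. m)" using Z by (intro sum_mono) auto
    finally have "card (\<Union>i<k. Z i) \<le> k * m" by simp
    then show ?thesis using sub fin by (meson card_mono finite_subset le_trans)
  qed
  then show ?thesis by blast
qed

section \<open>The matrix exponential\<close>

lemma bounded_linear_matrix_mult_left: "bounded_linear (\<lambda>X::real^'n^'n. A ** X)"
  for A :: "real^'n^'n"
  unfolding linear_conv_bounded_linear[symmetric]
  by (rule linearI)
     (simp_all add: vec_eq_iff matrix_matrix_mult_def sum.distrib distrib_left sum_distrib_left mult.left_commute)

lemma bounded_linear_transpose: "bounded_linear (transpose :: real^'n^'n \<Rightarrow> _)"
  unfolding linear_conv_bounded_linear[symmetric]
  by (rule linearI) (simp_all add: vec_eq_iff transpose_def)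

lemma bounded_linear_entry: "bounded_linear (\<lambda>X::real^'n^'n. X $ i $ j)"
  unfolding linear_conv_bounded_linear[symmetric] by (rule linearI) simp_all

abbreviation matpow :: "real^'n^'n \<Rightarrow> nat \<Rightarrow> real^'n^'n" where
  "matpow A k \<equiv> (((**) A) ^^ k) (mat 1)"

lemma matpow_scaleR: "matpow (t *\<^sub>R A) k = t ^ k *\<^sub>R matpow A k"
  by (induction k) (simp_all add: vec_eq_iff matrix_matrix_mult_def sum_distrib_left ac_simps)

lemma matpow_commute: "A ** matpow A k = matpow A k ** A"
  by (induction k) (simp_all add: matrix_mul_assoc)

lemma transpose_matpow: "transpose (matpow A k) = matpow (transpose A) k"
proof (induction k)
  case (Suc k)
  have "transpose (matpow A (Suc k)) = transpose (matpow A k ** A)"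
    by (simp add: matpow_commute)
  then show ?case using Suc by (simp add: matrix_transpose_mul)
qed simp

lemma norm_matpow_bound: "\<exists>C>0. \<forall>k. norm (matpow A k) \<le> C ^ k * norm (mat 1 :: real^'n^'n)"
  for A :: "real^'n^'n"
proof -
  obtain C where C: "C > 0" "\<And>X::real^'n^'n. norm (A ** X) \<le> norm X * C"
    using bounded_linear.pos_bounded[OF bounded_linear_matrix_mult_left[of A]] by blast
  have "norm (matpow A k) \<le> C ^ k * norm (mat 1 :: real^'n^'n)" for k
  proof (induction k)
    case (Suc k)
    have "norm (matpow A (Suc k)) \<le> norm (matpow A k) * C" using C(2) by simp
    also have "\<dots> \<le> (C ^ k * norm (mat 1 :: real^'n^'n)) * C"
      using Suc C(1) by (intro mult_right_mono) auto
    finally show ?case by (simp add: ac_simps)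
  qed simp
  then show ?thesis using C(1) by blast
qed

lemma matrix_exp_sums: "(\<lambda>k. (1 / fact k) *\<^sub>R matpow A k) sums matrix_exp A"
proof -
  obtain C where C: "C > 0" "\<And>k. norm (matpow A k) \<le> C ^ k * norm (mat 1 :: real^'a^'a)"
    using norm_matpow_bound[of A] by blast
  have "summable (\<lambda>k. (1 / fact k) *\<^sub>R matpow A k)"
  proof (rule summable_comparison_test')
    show "summable (\<lambda>k. (C ^ k /\<^sub>R fact k) * norm (mat 1 :: real^'a^'a))"
      by (intro summable_mult2 summable_exp_generic)
    fix k show "norm ((1 / fact k) *\<^sub>R matpow A k) \<le> (C ^ k /\<^sub>R fact k) * norm (mat 1 :: real^'a^'a)"
      using C(2)[of k] by (simp add: divide_simps)
  qed
  then show ?thesis unfolding matrix_exp_def by (rule summable_sums)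
qed

lemma matrix_exp_0 [simp]: "matrix_exp 0 = mat 1"
proof -
  have "(\<lambda>k. (1 / fact k) *\<^sub>R matpow (0::real^'a^'a) k) sums (\<Sum>k\<in>{0}. (1 / fact k) *\<^sub>R matpow 0 k)"
  proof (rule sums_finite)
    fix k :: nat assume "k \<notin> {0}"
    then obtain l where "k = Suc l" by (cases k) auto
    then show "(1 / fact k) *\<^sub>R matpow (0::real^'a^'a) k = 0" by simp
  qed simp
  then show ?thesis using sums_unique2[OF matrix_exp_sums] by fastforce
qed

lemma transpose_matrix_exp: "transpose (matrix_exp A) = matrix_exp (transpose A)"
  using bounded_linear.sums[OF bounded_linear_transpose matrix_exp_sums[of A]]
    matrix_exp_sums[of "transpose A"]
  by (simp add: linear_cmul[OF bounded_linear.linear[OF bounded_linear_transpose]] transpose_matpow sums_iff)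

text \<open>Each entry is a real power series in \<open>t\<close> and may be differentiated
  termwise; the index shift in \<open>diffs\<close> produces exactly the extra factor
  \<open>B\<close> on the left.\<close>

lemma matrix_exp_entry_has_derivative:
  fixes B :: "real^'n^'n"
  shows "((\<lambda>t. matrix_exp (t *\<^sub>R B) $ i $ j) has_real_derivative
     (B ** matrix_exp (t *\<^sub>R B)) $ i $ j) (at t)"
proof -
  define c where "c k = matpow B k $ i $ j / fact k" for k
  \<comment> \<open>Stated for a general linear \<open>F\<close> because it is used for the identity
    and for left multiplication by \<open>B\<close>.\<close>
  have sums: "(\<lambda>k. (1 / fact k) *\<^sub>R ((F (matpow B k)) $ i $ j * t ^ k)) sums (F (matrix_exp (t *\<^sub>R B)) $ i $ j)"
    if F: "bounded_linear F" for F :: "real^'n^'n \<Rightarrow> real^'n^'n" and t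
    using bounded_linear.sums[OF bounded_linear_entry bounded_linear.sums[OF F matrix_exp_sums[of "t *\<^sub>R B"]], of i j]
    by (simp add: matpow_scaleR linear_cmul[OF bounded_linear.linear[OF F]] ac_simps)
  have c: "(\<lambda>k. c k * t ^ k) sums (matrix_exp (t *\<^sub>R B) $ i $ j)" for t
    using sums[OF bounded_linear_ident, of t] by (simp add: c_def)
  have "diffs c k = (1 / fact k) * (B ** matpow B k) $ i $ j" for k
    by (simp add: diffs_def c_def del: of_nat_Suc)
  then have "(\<lambda>k. diffs c k * t ^ k) sums ((B ** matrix_exp (t *\<^sub>R B)) $ i $ j)"
    using sums[OF bounded_linear_matrix_mult_left, of B t] by (simp add: ac_simps)
  moreover have "((\<lambda>x. \<Sum>n. c n * x^n) has_field_derivative (\<Sum>n. diffs c n * t^n)) (at t)"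
    using c by (intro termdiffs_strong_converges_everywhere) (auto simp: sums_iff)
  ultimately show ?thesis using c by (simp add: sums_iff)
qed

lemma continuous_matrix_exp: "continuous_on S (\<lambda>t. matrix_exp (t *\<^sub>R B))"
proof -
  have "continuous_on S (\<lambda>t. matrix_exp (t *\<^sub>R B) $ i $ j)" for i j
    using matrix_exp_entry_has_derivative[of B i j]
    by (intro continuous_at_imp_continuous_on) (auto intro: DERIV_isCont)
  then have "continuous_on S (\<lambda>t. \<chi> i j. matrix_exp (t *\<^sub>R B) $ i $ j)"
    by (intro continuous_on_vec_lambda)
  then show ?thesis by simp
qed

section \<open>Exponentially decaying functions\<close>

definition exp_decaying :: "(real \<Rightarrow> 'a::real_normed_vector) \<Rightarrow> bool" where
  "exp_decaying f \<longleftrightarrow> (\<exists>C a. a > 0 \<and> (\<forall>t\<ge>0. norm (f t) \<le> C * exp (- a * t)))"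

lemma exp_decaying_bound:
  assumes "exp_decaying f"
  shows "\<exists>C a. C \<ge> 0 \<and> a > 0 \<and> (\<forall>t\<ge>0. norm (f t) \<le> C * exp (- a * t))"
proof -
  obtain C a where "a > 0" "\<And>t. t \<ge> 0 \<Longrightarrow> norm (f t) \<le> C * exp (- a * t)"
    using assms unfolding exp_decaying_def by blast
  moreover from this(2)[of 0] have "C \<ge> 0" using norm_ge_zero[of "f 0"] by (simp del: norm_ge_zero)
  ultimately show ?thesis by blast
qed

lemma exp_decaying_add:
  assumes "exp_decaying f" "exp_decaying g"
  shows "exp_decaying (\<lambda>t. f t + g t)"
proof -
  obtain C a where f: "C \<ge> 0" "a > 0" "\<And>t. t \<ge> 0 \<Longrightarrow> norm (f t) \<le> C * exp (- a * t)"
    using exp_decaying_bound[OF assms(1)] by blast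
  obtain D b where g: "D \<ge> 0" "b > 0" "\<And>t. t \<ge> 0 \<Longrightarrow> norm (g t) \<le> D * exp (- b * t)"
    using exp_decaying_bound[OF assms(2)] by blast
  have "norm (f t + g t) \<le> (C + D) * exp (- min a b * t)" if "t \<ge> 0" for t
  proof -
    have "C * exp (- a * t) \<le> C * exp (- min a b * t)" "D * exp (- b * t) \<le> D * exp (- min a b * t)"
      using that f g by (intro mult_left_mono; simp add: mult_right_mono)+
    then show ?thesis using f(3)[OF that] g(3)[OF that] norm_triangle_ineq[of "f t" "g t"]
      by (simp add: distrib_right)
  qed
  then show ?thesis unfolding exp_decaying_def using f g by (intro exI[of _ "C + D"] exI[of _ "min a b"]) auto
qed

lemma exp_decaying_mono:
  assumes "exp_decaying f" "\<And>t. t \<ge> 0 \<Longrightarrow> norm (g t) \<le> K * norm (f t)"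
  shows "exp_decaying g"
proof -
  obtain C a where f: "C \<ge> 0" "a > 0" "\<And>t. t \<ge> 0 \<Longrightarrow> norm (f t) \<le> C * exp (- a * t)"
    using exp_decaying_bound[OF assms(1)] by blast
  have "norm (g t) \<le> (\<bar>K\<bar> * C) * exp (- a * t)" if "t \<ge> 0" for t
  proof -
    have "norm (g t) \<le> \<bar>K\<bar> * norm (f t)"
      using assms(2)[OF that] by (rule order_trans) (intro mult_right_mono; simp)
    also have "\<dots> \<le> \<bar>K\<bar> * (C * exp (- a * t))" using f(3)[OF that] by (intro mult_left_mono) auto
    finally show ?thesis by (simp add: ac_simps)
  qed
  then show ?thesis unfolding exp_decaying_def using f by blast
qed

lemma exp_decaying_zero: "exp_decaying (\<lambda>t. 0)"
  unfolding exp_decaying_def by (rule exI[of _ 0], rule exI[of _ 1]) simp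

lemma exp_decaying_sum:
  assumes "\<And>i. i \<in> I \<Longrightarrow> exp_decaying (f i)"
  shows "exp_decaying (\<lambda>t. \<Sum>i\<in>I. f i t)"
  using assms by (induction I rule: infinite_finite_induct) (auto intro: exp_decaying_zero exp_decaying_add)

lemma exp_decaying_componentwise:
  assumes "\<And>i. exp_decaying (\<lambda>t. w t $ i)"
  shows "exp_decaying w"
proof (rule exp_decaying_mono[where K=1])
  have "exp_decaying (\<lambda>t. norm (w t $ i))" for i
    by (rule exp_decaying_mono[where K=1, OF assms[of i]]) simp
  then show "exp_decaying (\<lambda>t. \<Sum>i\<in>UNIV. norm (w t $ i))"
    by (rule exp_decaying_sum)
qed (simp add: norm_vec_def L2_set_le_sum order_trans[OF L2_set_le_sum] sum_nonneg)

lemma exp_decaying_mult: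
  fixes f g :: "real \<Rightarrow> 'a::real_normed_algebra"
  assumes "exp_decaying f" "exp_decaying g"
  shows "exp_decaying (\<lambda>t. f t * g t)"
proof -
  obtain C a where f: "C \<ge> 0" "a > 0" "\<And>t. t \<ge> 0 \<Longrightarrow> norm (f t) \<le> C * exp (- a * t)"
    using exp_decaying_bound[OF assms(1)] by blast
  show ?thesis
  proof (rule exp_decaying_mono[OF assms(2), where K=C])
    fix t :: real assume "t \<ge> 0"
    then have "norm (f t) \<le> C" using f(3)[of t] f(1,2)
      by (smt (verit) exp_le_one_iff mult_left_le mult_nonneg_nonneg mult_minus_left)
    then show "norm (f t * g t) \<le> C * norm (g t)"
      using norm_mult_ineq[of "f t" "g t"] mult_right_mono[of "norm (f t)" C "norm (g t)"] by simp
  qed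
qed

text \<open>Variation of constants: \<open>h\<close> is the solution with its homogeneous part
  divided out, so its derivative is controlled by \<open>u\<close> alone. The rate of the conclusion
  may be worse than both given rates.\<close>

lemma exp_decaying_linear_ode:
  fixes g u :: "real \<Rightarrow> complex"
  assumes d: "\<And>t. (g has_vector_derivative z * g t + u t) (at t)" and "Re z < 0" "exp_decaying u"
  shows "exp_decaying g"
proof -
  obtain C a where u: "C \<ge> 0" "a > 0" "\<And>t. t \<ge> 0 \<Longrightarrow> norm (u t) \<le> C * exp (- a * t)"
    using exp_decaying_bound[OF assms(3)] by blast
  define r where "r = - Re z"
  \<comment> \<open>If the rate of \<open>u\<close> equals \<open>r\<close>, a factor
    \<open>t\<close> would appear. A rate strictly below \<open>r\<close> avoids this resonance and
    keeps \<open>r - b\<close> positive in the primitive \<open>\<phi>\<close>.\<close>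
  define b where "b = min a r / 2"
  have r: "r > 0" using assms(2) by (simp add: r_def)
  have b: "b > 0" "b < r" "b < a" using r u(2) by (auto simp: b_def min_def)
  define h where "h t = exp (- z * of_real t) * g t" for t
  define \<phi> where "\<phi> t = C / (r - b) * exp ((r - b) * t)" for t
  have nexp: "norm (exp (- z * of_real t)) = exp (r * t)" for t
    by (simp add: r_def)
  have e': "((\<lambda>t. exp (- z * of_real t)) has_vector_derivative - z * exp (- z * of_real t)) (at t)" for t :: real
    by (auto intro!: derivative_eq_intros has_vector_derivative_real_field)
  have h': "(h has_vector_derivative exp (- z * of_real t) * u t) (at t)" for t
    unfolding h_def by (rule has_vector_derivative_eq_rhs[OF has_vector_derivative_mult[OF e' d]])
      (simp add: algebra_simps)
  have \<phi>': "(\<phi> has_real_derivative C * exp ((r - b) * t)) (at t)" for t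
    unfolding \<phi>_def using b by (auto intro!: derivative_eq_intros)
  have "norm (g t) \<le> (norm (g 0) + C / (r - b)) * exp (- b * t)" if "t \<ge> 0" for t
  proof (cases "t = 0")
    case True
    then show ?thesis using u(1) b by simp
  next
    case False
    have bnd: "norm (exp (- z * of_real x) * u x) \<le> C * exp ((r - b) * x)" if "x > 0" for x
    proof -
      have "norm (exp (- z * of_real x) * u x) \<le> exp (r * x) * (C * exp (- a * x))"
        unfolding norm_mult nexp using u(3)[of x] that by (intro mult_left_mono) auto
      also have "\<dots> = C * exp ((r - a) * x)" by (simp add: exp_add[symmetric] algebra_simps exp_diff)
      also have "\<dots> \<le> C * exp ((r - b) * x)" using u(1) b that by (intro mult_left_mono) auto
      finally show ?thesis .
    qed
    have "norm (h t - h 0) \<le> \<phi> t - \<phi> 0"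
      using False that h' \<phi>' bnd
      by (intro differentiable_bound_general[where f'="\<lambda>x. exp (- z * of_real x) * u x" and \<phi>'="\<lambda>x. C * exp ((r - b) * x)"])
         (auto simp: has_real_derivative_iff_has_vector_derivative
           intro!: continuous_at_imp_continuous_on intro: has_vector_derivative_continuous)
    moreover have "\<phi> 0 \<ge> 0" using u(1) b by (simp add: \<phi>_def)
    ultimately have "norm (h t) \<le> norm (g 0) + \<phi> t"
      using norm_triangle_ineq2[of "h t" "h 0"] by (simp add: h_def)
    then have "exp (r * t) * norm (g t) \<le> norm (g 0) + \<phi> t"
      by (simp only: h_def norm_mult nexp)
    moreover have "norm (g t) = exp (- r * t) * (exp (r * t) * norm (g t))"
      by (simp add: exp_minus)
    ultimately have "norm (g t) \<le> exp (- r * t) * (norm (g 0) + \<phi> t)"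
      by (metis exp_ge_zero mult_left_mono)
    also have "\<dots> = exp (- r * t) * norm (g 0) + C / (r - b) * exp (- b * t)"
      by (simp add: \<phi>_def distrib_left exp_add[symmetric] algebra_simps flip: exp_add)
    also have "\<dots> \<le> exp (- b * t) * norm (g 0) + C / (r - b) * exp (- b * t)"
      using b that by (intro add_right_mono mult_right_mono) (auto intro: mult_right_mono)
    finally show ?thesis by (simp add: algebra_simps)
  qed
  then show ?thesis unfolding exp_decaying_def using b by blast
qed

section \<open>Polynomials of a matrix acting on vectors, and decay of the matrix
  exponential\<close>

definition poly_act :: "'a::field^'n^'n \<Rightarrow> 'a poly \<Rightarrow> 'a^'n \<Rightarrow> 'a^'n" where
  "poly_act A p v = (\<Sum>k\<le>degree p. coeff p k *s ((*v) A ^^ k) v)"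

lemma poly_act_altdef:
  assumes "degree p \<le> N"
  shows "poly_act A p v = (\<Sum>k\<le>N. coeff p k *s ((*v) A ^^ k) v)"
  unfolding poly_act_def using assms
  by (intro sum.mono_neutral_left) (auto simp: coeff_eq_0)

lemma matrix_vector_sum: "A *v (\<Sum>i\<in>I. f i) = (\<Sum>i\<in>I. A *v f i)" for A :: "'a::field^'n^'m"
  by (induction I rule: infinite_finite_induct) (simp_all add: matrix_vector_right_distrib)

lemma poly_act_linear_factor:
  "poly_act A ([:-z, 1:] * q) v = A *v poly_act A q v - z *s poly_act A q v"
proof -
  define N where "N = Suc (degree q)"
  have N: "degree q \<le> N" "degree q \<le> degree q" "degree ([:-z, 1:] * q) \<le> N"
    using degree_mult_le[of "[:-z, 1:]" q] by (auto simp: N_def)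
  have "poly_act A ([:-z, 1:] * q) v
      = (\<Sum>k\<le>N. coeff (pCons 0 q) k *s ((*v) A ^^ k) v) - z *s (\<Sum>k\<le>N. coeff q k *s ((*v) A ^^ k) v)"
    unfolding poly_act_altdef[OF N(3)]
    by (simp add: vec.scale_sum_right sum_subtractf[symmetric] vec.scale_left_diff_distrib)
  also have "(\<Sum>k\<le>N. coeff (pCons 0 q) k *s ((*v) A ^^ k) v) = A *v poly_act A q v"
    unfolding N_def sum.atMost_Suc_shift poly_act_def
    by (simp add: matrix_vector_sum vector_scalar_commute)
  finally show ?thesis unfolding poly_act_altdef[OF N(1)] .
qed

text \<open>The factor A - z may thus act before or after q(A). Acting after, it shows that q(A) w
  is zero or an eigenvector; acting before, it shows that q annihilates (A - z) w.\<close>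

lemma poly_act_commute: "poly_act A q (A *v v - z *s v) = A *v poly_act A q v - z *s poly_act A q v"
proof -
  have "((*v) A ^^ k) (A *v v - z *s v) = A *v ((*v) A ^^ k) v - z *s ((*v) A ^^ k) v" for k
    by (induction k) (simp_all add: matrix_vector_mult_diff_distrib vector_scalar_commute)
  then show ?thesis
    by (simp add: poly_act_def matrix_vector_sum vec.scale_sum_right vector_scalar_commute
        vec.scale_right_diff_distrib sum_subtractf vector_smult_assoc mult.commute)
qed

text \<open>The induction removes one root \<open>z\<close> of the annihilating polynomial at a time: either \<open>z\<close> is
  not an eigenvalue and \<open>A - z\<close> is injective, or \<open>(A - z) w\<close> decays and so does \<open>w\<close>.\<close>

lemma exp_decaying_annihilated:
  fixes A :: "complex^'n^'n"
  assumes stable: "\<And>z v. v \<noteq> 0 \<Longrightarrow> A *v v = z *s v \<Longrightarrow> Re z < 0"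
    and "p \<noteq> 0"
    and "\<And>t i. ((\<lambda>t. w t $ i) has_vector_derivative (A *v w t) $ i) (at t)"
    and "\<And>t. poly_act A p (w t) = 0"
  shows "exp_decaying w"
  using assms(2-)
proof (induction "degree p" arbitrary: p w)
  case 0
  then have "p = [:coeff p 0:]" "coeff p 0 \<noteq> 0"
    by (metis degree_eq_zeroE coeff_pCons_0, metis leading_coeff_0_iff)
  moreover have "poly_act A p (w t) = coeff p 0 *s w t" for t
    using 0 by (simp add: poly_act_def flip: 0(1))
  ultimately have "w t = 0" for t using 0 by (simp add: vec.scale_eq_0_iff)
  then show ?case using exp_decaying_zero by (simp add: exp_decaying_def)
next
  case (Suc d)
  obtain z where "poly p z = 0"
    using alg_closed_imp_poly_has_root[of p] Suc by auto
  then obtain q where q: "p = [:-z, 1:] * q" by (metis dvdE poly_eq_0_iff_dvd)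
  then have q0: "q \<noteq> 0" using Suc by auto
  then have "degree p = Suc (degree q)" unfolding q by (subst degree_mult_eq) auto
  then have dq: "d = degree q" using Suc by simp
  show ?case
  proof (cases "\<exists>v. v \<noteq> 0 \<and> A *v v = z *s v")
    case False
    then have "poly_act A q (w t) = 0" for t
      using Suc.prems(3)[of t] unfolding q poly_act_linear_factor by auto
    then show ?thesis using Suc.hyps(1)[OF dq q0] Suc.prems by blast
  next
    case True
    then have z: "Re z < 0" using stable by blast
    define u where "u t = A *v w t - z *s w t" for t
    have "poly_act A q (u t) = 0" for t
      using Suc.prems(3)[of t] unfolding q poly_act_linear_factor u_def poly_act_commute .
    \<comment> \<open>\<open>A\<close> commutes with A - z, so \<open>u\<close> solves the same
      differential equation as \<open>w\<close>.\<close>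
    moreover have "((\<lambda>t. u t $ i) has_vector_derivative (A *v u t) $ i) (at t)" for t i
    proof -
      have "((\<lambda>t. u t $ i) has_vector_derivative (\<Sum>j\<in>UNIV. A $ i $ j * (A *v w t) $ j) - z * (A *v w t) $ i) (at t)"
        unfolding u_def vector_minus_component vector_smult_component
        by (subst (1) matrix_vector_mult_def, subst vec_lambda_beta)
           (intro has_vector_derivative_diff has_vector_derivative_sum has_vector_derivative_mult_right Suc.prems(2))
      moreover have "(A *v u t) $ i = (\<Sum>j\<in>UNIV. A $ i $ j * (A *v w t) $ j) - z * (A *v w t) $ i"
        unfolding u_def matrix_vector_mult_diff_distrib vector_scalar_commute
        by (simp add: matrix_vector_mult_def)
      ultimately show ?thesis by simp
    qed
    ultimately have "exp_decaying u" using Suc.hyps(1)[OF dq q0, of u] by blast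
    show ?thesis
    proof (rule exp_decaying_componentwise)
      fix i
      have "exp_decaying (\<lambda>t. u t $ i)"
        by (rule exp_decaying_mono[where K=1, OF \<open>exp_decaying u\<close>]) (simp add: Finite_Cartesian_Product.norm_nth_le)
      \<comment> \<open>By the definition of \<open>u\<close>, the system w' = A w reads w' = z w +
        u, which is scalar in each component.\<close>
      moreover have "((\<lambda>t. w t $ i) has_vector_derivative z * w t $ i + u t $ i) (at t)" for t
        using Suc.prems(2)[of i t] by (simp add: u_def)
      ultimately show "exp_decaying (\<lambda>t. w t $ i)"
        using exp_decaying_linear_ode[of "\<lambda>t. w t $ i" z "\<lambda>t. u t $ i"] z by blast
    qed
  qed
qed

theorem matrix_exp_decaying:
  fixes B :: "real^'n^'n"
  assumes "\<And>z. complex_eigenvalue B z \<Longrightarrow> Re z < 0"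
  shows "exp_decaying (\<lambda>t. matrix_exp (t *\<^sub>R B) $ i $ j)"
proof -
  let ?A = "map_matrix complex_of_real B"
  \<comment> \<open>The powers of \<open>B\<close> lie in a finite-dimensional space, so some power
    depends on the earlier ones. This relation is read as the monic annihilating polynomial
    \<open>p\<close>.\<close>
  obtain m where "matpow B m \<in> span (matpow B ` {..<m})"
    using real_vector.exists_in_span_of_previous[OF finite_Basis, of "matpow B"] by auto
  then obtain a where a: "matpow B m = (\<Sum>k<m. a k *\<^sub>R matpow B k)"
    using real_vector.span_image_lessThan by blast
  define p where "p = monom 1 m - (\<Sum>k<m. monom (complex_of_real (a k)) k)"
  have coeff_p: "coeff p k = (if k = m then 1 else if k < m then - of_real (a k) else 0)" for k
    by (auto simp: p_def coeff_sum)
  then have "p \<noteq> 0" by (metis coeff_0 zero_neq_one)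
  have deg: "degree p \<le> m" using coeff_p by (intro degree_le) auto
  define cplx :: "real^'n \<Rightarrow> complex^'n" where "cplx x = (\<chi> i. of_real (x $ i))" for x
  have mult: "?A *v cplx x = cplx (B *v x)" for x
    by (simp add: cplx_def matrix_vector_mult_def vec_eq_iff)
  have pow: "((*v) ?A ^^ k) (cplx x) = cplx (matpow B k *v x)" for k x
    by (induction k) (simp_all add: mult matrix_vector_mul_assoc)
  have act: "poly_act ?A p (cplx x) = 0" for x
  proof -
    have "cplx (matpow B m *v x) = (\<Sum>k<m. of_real (a k) *s cplx (matpow B k *v x))"
      unfolding a by (simp add: vec_eq_iff cplx_def matrix_vector_mult_def sum_component sum_distrib_left
          sum_distrib_right mult.assoc) (use sum.swap in fast)
    then show ?thesis
      unfolding poly_act_altdef[OF deg] pow lessThan_Suc_atMost[symmetric]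
      by (simp add: coeff_p sum_negf)
  qed
  \<comment> \<open>The j-th column of the exponential, complexified because the roots of
    \<open>p\<close> need not be real.\<close>
  define w where "w t = cplx (\<chi> i. matrix_exp (t *\<^sub>R B) $ i $ j)" for t
  have "exp_decaying w"
  proof (rule exp_decaying_annihilated[OF _ \<open>p \<noteq> 0\<close>])
    show "Re z < 0" if "v \<noteq> 0" "?A *v v = z *s v" for z v
      using assms[of z] that unfolding complex_eigenvalue_def by blast
    show "((\<lambda>t. w t $ i) has_vector_derivative (?A *v w t) $ i) (at t)" for t i
    proof -
      have "((\<lambda>t. w t $ i) has_vector_derivative of_real ((B ** matrix_exp (t *\<^sub>R B)) $ i $ j)) (at t)"
        unfolding w_def cplx_def using matrix_exp_entry_has_derivative[of B i j t]
        by (simp add: has_vector_derivative_of_real has_real_derivative_iff_has_vector_derivative)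
      then show ?thesis unfolding w_def mult
        by (simp add: cplx_def matrix_vector_mult_def matrix_matrix_mult_def)
    qed
    show "poly_act ?A p (w t) = 0" for t unfolding w_def by (rule act)
  qed
  then show ?thesis
  proof (rule exp_decaying_mono[where K=1])
    fix t :: real
    show "norm (matrix_exp (t *\<^sub>R B) $ i $ j) \<le> 1 * norm (w t)"
      using Finite_Cartesian_Product.norm_nth_le[of "w t" i] by (simp add: w_def cplx_def)
  qed
qed

section \<open>Covariance matrices\<close>

definition pos_def :: "real^'n^'n \<Rightarrow> bool" where
  "pos_def A \<longleftrightarrow> (\<forall>x. x \<noteq> 0 \<longrightarrow> (A *v x) \<bullet> x > 0)"

lemma pos_def_invertible:
  assumes "pos_def A"
  shows "invertible A"
proof -
  have "x = 0" if "A *v x = 0" for x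
    using assms that unfolding pos_def_def by (metis inner_zero_left less_irrefl)
  then have "\<exists>B. B ** A = mat 1"
    using matrix_left_invertible_ker by blast
  then show ?thesis by (simp add: invertible_left_inverse)
qed

lemma continuous_on_det:
  fixes A :: "'a::topological_space \<Rightarrow> real^'n^'n"
  assumes "\<And>i j. continuous_on S (\<lambda>x. A x $ i $ j)"
  shows "continuous_on S (\<lambda>x. det (A x))"
  unfolding det_def by (intro continuous_intros assms)

lemma tendsto_det_entrywise:
  fixes A :: "'a \<Rightarrow> real^'n^'n"
  assumes "\<And>i j. ((\<lambda>x. A x $ i $ j) \<longlongrightarrow> L $ i $ j) F"
  shows "((\<lambda>x. det (A x)) \<longlongrightarrow> det L) F"
  unfolding det_def by (intro tendsto_intros assms)

text \<open>The segment from the identity to \<open>A\<close> consists of positive definite, hence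
  invertible, matrices. The determinant starts at 1 and by continuity cannot become nonpositive
  without vanishing on the way.\<close>

lemma pos_def_det_pos:
  assumes "pos_def A"
  shows "det A > 0"
proof (rule ccontr)
  assume "\<not> ?thesis"
  define P where "P s = (1 - s) *\<^sub>R mat 1 + s *\<^sub>R A" for s :: real
  have P: "pos_def (P s)" if "s \<in> {0..1}" for s
    unfolding pos_def_def
  proof (intro allI impI)
    fix x :: "real^'a" assume "x \<noteq> 0"
    then have "x \<bullet> x > 0" "(A *v x) \<bullet> x > 0" using assms by (auto simp: pos_def_def)
    moreover have "(P s *v x) \<bullet> x = (1 - s) * (x \<bullet> x) + s * ((A *v x) \<bullet> x)"
      unfolding P_def by (simp add: matrix_vector_mult_add_rdistrib scaleR_matrix_vector_assoc[symmetric] inner_add_left)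
    ultimately show "(P s *v x) \<bullet> x > 0"
      using that by (cases "s = 0") (auto intro!: add_nonneg_pos)
  qed
  have "continuous_on {0..1} (\<lambda>s. det (P s))"
    by (intro continuous_on_det) (auto simp: P_def intro!: continuous_intros)
  moreover have "det (P 1) \<le> 0" "det (P 0) = 1"
    using \<open>\<not> det A > 0\<close> by (simp_all add: P_def)
  ultimately obtain s where "s \<in> {0..1}" "det (P s) = 0"
    using IVT2'[of "\<lambda>s. det (P s)" 1 0 0] by auto
  then show False
    using pos_def_invertible[OF P] invertible_det_nz by blast
qed

lemma inner_matrix_vector_mult_left: "(A *v x) \<bullet> y = x \<bullet> (transpose A *v y)" for A :: "real^'n^'m"
  unfolding transpose_matrix_vector using dot_lmul_matrix[of y A x] by (simp only: inner_commute)

context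
  fixes B Q :: "real^'n^'n"
  assumes stable: "\<And>z. complex_eigenvalue B z \<Longrightarrow> Re z < 0" and Q: "pos_def Q"
begin

definition cov_integrand :: "real \<Rightarrow> real^'n^'n" where
  "cov_integrand s = matrix_exp (s *\<^sub>R B) ** Q ** matrix_exp (s *\<^sub>R transpose B)"

text \<open>This separates \<open>Q\<close> from \<open>B\<close>: the entries of \<open>Q\<close>
  are mere coefficients of functions that depend on \<open>B\<close> only.\<close>

lemma cov_integrand_entry:
  "cov_integrand s $ i $ j = (\<Sum>k\<in>UNIV. \<Sum>l\<in>UNIV.
     Q $ l $ k * (matrix_exp (s *\<^sub>R B) $ i $ l * matrix_exp (s *\<^sub>R transpose B) $ k $ j))"
  unfolding cov_integrand_def matrix_matrix_mult_def vec_lambda_beta sum_distrib_right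
  by (intro sum.cong refl) (simp only: ac_simps)

lemma continuous_cov_integrand: "continuous_on S cov_integrand"
proof -
  have "continuous_on S (\<lambda>s. cov_integrand s $ i $ j)" for i j
    unfolding cov_integrand_entry
    by (intro continuous_intros continuous_on_component continuous_matrix_exp)
  then have "continuous_on S (\<lambda>s. \<chi> i j. cov_integrand s $ i $ j)"
    by (intro continuous_on_vec_lambda)
  then show ?thesis by simp
qed

lemma exp_decaying_cov_integrand: "exp_decaying cov_integrand"
proof (intro exp_decaying_componentwise)
  fix i j
  have "exp_decaying (\<lambda>t. matrix_exp (t *\<^sub>R B) $ i $ j)" for i j
    by (rule matrix_exp_decaying[OF stable])
  moreover have "matrix_exp (t *\<^sub>R transpose B) $ i $ j = matrix_exp (t *\<^sub>R B) $ j $ i" for t i j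
  proof -
    have "t *\<^sub>R transpose B = transpose (t *\<^sub>R B)" by (simp add: vec_eq_iff transpose_def)
    then show ?thesis by (simp only: transpose_matrix_exp[symmetric]) (simp add: transpose_def)
  qed
  ultimately have dec: "exp_decaying (\<lambda>s. matrix_exp (s *\<^sub>R B) $ i $ l * matrix_exp (s *\<^sub>R transpose B) $ k $ j)" for l k
    by (simp add: exp_decaying_mult)
  have "exp_decaying (\<lambda>s. Q $ l $ k * (matrix_exp (s *\<^sub>R B) $ i $ l * matrix_exp (s *\<^sub>R transpose B) $ k $ j))" for l k
    by (rule exp_decaying_mono[OF dec[of l k], where K="\<bar>Q $ l $ k\<bar>"]) (simp add: abs_mult)
  then show "exp_decaying (\<lambda>s. cov_integrand s $ i $ j)"
    unfolding cov_integrand_entry by (intro exp_decaying_sum)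
qed

text \<open>At infinity the exponential decay supplies a dominating function. Without integrability,
  \<open>integral\<close> in \<open>Qcov\<close> would return its default value 0.\<close>

lemma cov_integrand_integrable: "cov_integrand integrable_on {s. 0 \<le> s \<and> ereal s \<le> t}"
proof -
  obtain C a where C: "a > 0" "\<And>t. t \<ge> 0 \<Longrightarrow> norm (cov_integrand t) \<le> C * exp (- a * t)"
    using exp_decaying_cov_integrand unfolding exp_decaying_def by blast
  have fin: "cov_integrand integrable_on {c..d}" for c d
    by (intro integrable_continuous_interval continuous_cov_integrand)
  show ?thesis
  proof (cases t)
    case (real r)
    then have "{s. 0 \<le> s \<and> ereal s \<le> t} = {0..r}" by auto
    then show ?thesis using fin by simp
  next
    case PInf
    then have "{s. 0 \<le> s \<and> ereal s \<le> t} = {0..}" by auto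
    moreover have "cov_integrand integrable_on {0..}"
    proof (rule integrable_on_all_intervals_integrable_bound[where g="\<lambda>t. C * exp (- a * t)"])
      fix c d :: real
      have "cov_integrand integrable_on ({0..} \<inter> cbox c d)"
      proof -
        have "{0..} \<inter> cbox c d = {max 0 c..d}" by auto
        then show ?thesis using fin by simp
      qed
      then show "(\<lambda>x. if x \<in> {0..} then cov_integrand x else 0) integrable_on cbox c d"
        by (simp only: integrable_restrict_Int)
    next
      show "(\<lambda>t. C * exp (- a * t)) integrable_on {0..}"
        using C by (intro integrable_on_mult_right integrable_on_exp_minus_to_infinity)
    qed (use C in auto)
    ultimately show ?thesis by simp
  next
    case MInf
    then have empty: "{s. 0 \<le> s \<and> ereal s \<le> t} = {}" by auto
    show ?thesis unfolding empty by (rule integrable_on_empty)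
  qed
qed

lemma cov_integrand_quadratic_form_nonneg:
  shows "(cov_integrand s *v y) \<bullet> y \<ge> 0"
    and "y \<noteq> 0 \<Longrightarrow> (cov_integrand 0 *v y) \<bullet> y > 0"
proof -
  have tr: "s *\<^sub>R transpose B = transpose (s *\<^sub>R B)" by (simp add: vec_eq_iff transpose_def)
  define z where "z = matrix_exp (s *\<^sub>R transpose B) *v y"
  have "(cov_integrand s *v y) \<bullet> y = (Q *v z) \<bullet> z"
    unfolding cov_integrand_def matrix_vector_mul_assoc[symmetric] z_def
      inner_matrix_vector_mult_left[of "matrix_exp (s *\<^sub>R B)"] transpose_matrix_exp tr ..
  then show "(cov_integrand s *v y) \<bullet> y \<ge> 0"
    using Q unfolding pos_def_def by (cases "z = 0") (auto intro: less_imp_le)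
  show "y \<noteq> 0 \<Longrightarrow> (cov_integrand 0 *v y) \<bullet> y > 0"
    using Q by (simp add: cov_integrand_def pos_def_def)
qed

text \<open>The quadratic form of the integrand is nonnegative, continuous, and positive at time 0,
  so its integral over a short interval from 0 is already positive. Restricting to that interval
  treats finite and infinite \<open>t\<close> together.\<close>

lemma pos_def_Qcov:
  assumes "t > 0"
  shows "pos_def (Qcov B Q t)"
  unfolding pos_def_def
proof (intro allI impI)
  fix y :: "real^'n" assume y: "y \<noteq> 0"
  define T where "T = {s. 0 \<le> s \<and> ereal s \<le> t}"
  define g where "g s = (cov_integrand s *v y) \<bullet> y" for s
  obtain \<tau> where \<tau>: "0 < \<tau>" "ereal \<tau> \<le> t"
    using ereal_dense2[OF assms] by (auto simp: zero_ereal_def intro: less_imp_le)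
  have sub: "{0..\<tau>} \<subseteq> T" using \<tau>(2) by (auto simp: T_def intro: order_trans[of "ereal _" "ereal \<tau>"])
  have bl: "bounded_linear (\<lambda>A::real^'n^'n. (A *v y) \<bullet> y)"
    unfolding linear_conv_bounded_linear[symmetric]
    by (rule linearI) (simp_all add: matrix_vector_mult_add_rdistrib inner_add_left scaleR_matrix_vector_assoc[symmetric])
  have int: "cov_integrand integrable_on T" unfolding T_def by (rule cov_integrand_integrable)
  have g_int: "g integrable_on T"
    unfolding g_def using integrable_linear[OF int bl] by (simp add: o_def)
  have "(Qcov B Q t *v y) \<bullet> y = integral T g"
    unfolding g_def using integral_linear[OF int bl]
    by (simp add: o_def Qcov_def T_def cov_integrand_def[abs_def])
  moreover have cont: "continuous_on {0..\<tau>} g"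
    unfolding g_def using continuous_on_compose2[OF linear_continuous_on[OF bl] continuous_cov_integrand] by blast
  moreover have "g s \<ge> 0" for s
    unfolding g_def by (rule cov_integrand_quadratic_form_nonneg)
  moreover from this have "integral {0..\<tau>} g \<le> integral T g"
    by (intro integral_subset_le sub g_int integrable_continuous_interval cont) auto
  moreover have "integral {0..\<tau>} g \<noteq> 0"
  proof -
    have "g 0 > 0" unfolding g_def by (rule cov_integrand_quadratic_form_nonneg(2)[OF y])
    moreover have "(0::real) \<in> {0..\<tau>}" using \<tau>(1) by simp
    ultimately show ?thesis
      using integral_eq_0_iff[OF cont \<tau>(1) \<open>\<And>s. g s \<ge> 0\<close>] by (metis less_irrefl)
  qed
  moreover have "integral {0..\<tau>} g \<ge> 0"
    using \<open>\<And>s. g s \<ge> 0\<close> by (intro integral_nonneg integrable_continuous_interval cont)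
  ultimately show "(Qcov B Q t *v y) \<bullet> y > 0" by linarith
qed

text \<open>The antiderivatives \<open>F\<close> can be fixed before \<open>Q\<close>, and the
  right-hand side is a formula that makes sense on the whole line.\<close>

lemma Qcov_entry:
  assumes F: "\<And>i j k l t. (F i j k l has_real_derivative
      matrix_exp (t *\<^sub>R B) $ i $ l * matrix_exp (t *\<^sub>R transpose B) $ k $ j) (at t)"
    and "t \<ge> 0"
  shows "Qcov B Q (ereal t) $ i $ j = (\<Sum>k\<in>UNIV. \<Sum>l\<in>UNIV. Q $ l $ k * (F i j k l t - F i j k l 0))"
proof -
  have T: "{s. 0 \<le> s \<and> ereal s \<le> ereal t} = {0..t}" by auto
  have "((\<lambda>s. cov_integrand s $ i $ j) has_integral
      (\<Sum>k\<in>UNIV. \<Sum>l\<in>UNIV. Q $ l $ k * (F i j k l t - F i j k l 0))) {0..t}"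
    unfolding cov_integrand_entry
    using F by (intro has_integral_sum has_integral_mult_right fundamental_theorem_of_calculus assms)
       (auto simp: has_real_derivative_iff_has_vector_derivative intro: has_vector_derivative_at_within)
  moreover have "(cov_integrand has_integral Qcov B Q (ereal t)) {0..t}"
    using integrable_integral[OF cov_integrand_integrable[of "ereal t"]]
    unfolding T by (simp only: Qcov_def T cov_integrand_def[abs_def])
  then have "((\<lambda>s. cov_integrand s $ i $ j) has_integral Qcov B Q (ereal t) $ i $ j) {0..t}"
    using has_integral_linear[OF _ bounded_linear_entry[of i j]] unfolding o_def by blast
  ultimately show ?thesis by (rule has_integral_unique[rotated])
qed

end

section \<open>Behaviour of the kernel as time tends to zero\<close>

lemma matrix_inv_right:
  fixes A :: "real^'n^'n"
  assumes "invertible A"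
  shows "A ** matrix_inv A = mat 1"
  using someI_ex[OF assms[unfolded invertible_def]] unfolding matrix_inv_def by blast

lemma matrix_inv_vector_unique:
  fixes A :: "real^'n^'n"
  assumes "invertible A" "A *v y = w"
  shows "matrix_inv A *v w = y"
  using assms matrix_inv_right[OF assms(1)]
  by (metis matrix_left_right_inverse matrix_vector_mul_assoc matrix_vector_mul_lid)

text \<open>The quadratic form of the adjugate of \<open>A\<close>. In contrast to the form of the
  inverse it is polynomial in the entries of \<open>A\<close> and \<open>w\<close>, and it remains
  meaningful for singular \<open>A\<close>, as occurs at time 0.\<close>

definition cramer_form :: "real^'n^'n \<Rightarrow> real^'n \<Rightarrow> real" where
  "cramer_form A w = (\<Sum>k\<in>UNIV. det (\<chi> i j. if j = k then w $ i else A $ i $ j) * w $ k)"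

lemma inverse_form_eq_cramer:
  fixes A :: "real^'n^'n"
  assumes "det A \<noteq> 0"
  shows "(matrix_inv A *v w) \<bullet> w = cramer_form A w / det A"
proof -
  have "invertible A" using assms invertible_det_nz by blast
  then have "A *v (matrix_inv A *v w) = w"
    by (simp add: matrix_vector_mul_assoc matrix_inv_right)
  then have "matrix_inv A *v w = (\<chi> k. det (\<chi> i j. if j = k then w $ i else A $ i $ j) / det A)"
    using cramer[OF assms] by blast
  then show ?thesis
    by (simp add: cramer_form_def inner_vec_def sum_divide_distrib)
qed

text \<open>Cramer's rule reduces continuity of the inverse to continuity of determinants.\<close>

lemma tendsto_inverse_form:
  fixes A :: "'a \<Rightarrow> real^'n^'n"
  assumes A: "\<And>i j. ((\<lambda>x. A x $ i $ j) \<longlongrightarrow> L $ i $ j) F"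
    and w: "\<And>i. ((\<lambda>x. w x $ i) \<longlongrightarrow> l $ i) F"
    and "det L \<noteq> 0" "eventually (\<lambda>x. det (A x) \<noteq> 0) F"
  shows "((\<lambda>x. (matrix_inv (A x) *v w x) \<bullet> w x) \<longlongrightarrow> (matrix_inv L *v l) \<bullet> l) F"
proof -
  have "((\<lambda>x. cramer_form (A x) (w x) / det (A x)) \<longlongrightarrow> cramer_form L l / det L) F"
    unfolding cramer_form_def
    by (intro tendsto_intros tendsto_det_entrywise assms) (auto intro: assms)
  then show ?thesis unfolding inverse_form_eq_cramer[OF assms(3)]
    by (rule Lim_transform_eventually) (use assms(4) in \<open>eventually_elim, simp add: inverse_form_eq_cramer\<close>)
qed

lemma pos_def_inverse_form_pos:
  assumes "pos_def A" "y \<noteq> 0"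
  shows "(matrix_inv A *v y) \<bullet> y > 0"
proof -
  define z where "z = matrix_inv A *v y"
  have y: "A *v z = y"
    unfolding z_def using pos_def_invertible[OF assms(1)]
    by (simp add: matrix_vector_mul_assoc matrix_inv_right)
  then have "z \<noteq> 0" using assms(2) by auto
  then show ?thesis
    using assms(1) unfolding pos_def_def z_def[symmetric] by (metis y inner_commute)
qed

lemma inverse_form_scale:
  fixes A :: "real^'n^'n"
  assumes "invertible A" "c \<noteq> 0"
  shows "(matrix_inv (c *\<^sub>R A) *v w) \<bullet> w = (matrix_inv A *v w) \<bullet> w / c"
proof -
  have "(c *\<^sub>R A) *v ((1 / c) *\<^sub>R (matrix_inv A *v w)) = A *v (matrix_inv A *v w)"
    using assms(2) by (simp add: scaleR_matrix_vector_assoc[symmetric] matrix_vector_mult_scaleR)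
  also have "\<dots> = w"
    using assms(1) by (simp add: matrix_vector_mul_assoc matrix_inv_right)
  finally have "matrix_inv (c *\<^sub>R A) *v w = (1 / c) *\<^sub>R (matrix_inv A *v w)"
    using assms by (intro matrix_inv_vector_unique scalar_invertible) auto
  then show ?thesis by simp
qed

lemma det_scaleR: "det (c *\<^sub>R A) = c ^ CARD('n) * det A" for A :: "real^'n^'n"
  by (simp add: det_def prod.distrib sum_distrib_left ac_simps)

lemma tendsto_mult_ln_0: "((\<lambda>t::real. t * ln t) \<longlongrightarrow> 0) (at_right 0)"
proof -
  have "((\<lambda>t::real. - (ln (inverse t) / inverse t)) \<longlongrightarrow> - 0) (at_right 0)"
    by (intro tendsto_minus filterlim_compose[OF ln_x_over_x_tendsto_0 filterlim_inverse_at_top_right])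
  moreover have "eventually (\<lambda>t::real. - (ln (inverse t) / inverse t) = t * ln t) (at_right 0)"
    using eventually_at_right_less[of 0] by eventually_elim (simp add: ln_inverse divide_inverse mult.commute)
  ultimately have "((\<lambda>t::real. t * ln t) \<longlongrightarrow> - 0) (at_right 0)"
    by (rule Lim_transform_eventually)
  then show ?thesis by simp
qed

text \<open>The phase behaves like \<open>n ln t + \<langle>Q\<^sup>-\<^sup>1 w, w\<rangle> / t\<close> as \<open>t\<close> tends to \<open>0\<close>. If \<open>w 0 \<noteq> 0\<close> the second
  term dominates; otherwise it tends to \<open>0\<close> and the logarithm remains.\<close>

lemma phase_not_constant:
  fixes A :: "real \<Rightarrow> real^'n^'n" and w :: "real \<Rightarrow> real^'n" and Q M :: "real^'n^'n"
  assumes A': "\<And>i j. ((\<lambda>t. A t $ i $ j) has_real_derivative Q $ i $ j) (at 0)"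
    and A0: "A 0 = 0" and Q: "pos_def Q" and det: "\<And>t. t > 0 \<Longrightarrow> det (A t) > 0"
    and w': "\<And>i. ((\<lambda>t. w t $ i) has_real_derivative w1 $ i) (at 0)"
    and const: "\<And>t. t > 0 \<Longrightarrow>
      ln (det (A t)) + ((matrix_inv (A t) - M) *v w t) \<bullet> w t = \<kappa>"
  shows False
proof -
  \<comment> \<open>The difference quotient of \<open>A\<close> at 0. It tends to the invertible
    matrix \<open>Q\<close>, so the singular behaviour of \<open>A\<close> is isolated in powers of
    \<open>t\<close>.\<close>
  define P where "P t = (1 / t) *\<^sub>R A t" for t
  let ?F = "at_right (0::real)"
  have pos: "eventually (\<lambda>t::real. t > 0) ?F" by (simp add: eventually_at_right_less)
  have AP: "A t = t *\<^sub>R P t" if "t > 0" for t using that by (simp add: P_def)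
  have quot: "((\<lambda>t. f t / t) \<longlongrightarrow> D) ?F"
    if "(f has_real_derivative D) (at 0)" "f 0 = 0" for f D
    using filterlim_mono[OF that(1)[unfolded has_field_derivative_iff] order_refl at_le[of "{0<..}" UNIV]] that(2)
    by simp
  have P: "((\<lambda>t. P t $ i $ j) \<longlongrightarrow> Q $ i $ j) ?F" for i j
    using quot[OF A'[of i j]] A0 by (simp add: P_def)
  have detA: "det (A t) = t ^ CARD('n) * det (P t)" if "t > 0" for t
    unfolding AP[OF that] by (rule det_scaleR)
  have detP: "det (P t) > 0" if "t > 0" for t
    using det[OF that] that unfolding detA[OF that] by (simp add: zero_less_mult_iff)
  have invP: "invertible (P t)" if "t > 0" for t
    using detP[OF that] invertible_det_nz by force
  have detQ: "det Q > 0" using pos_def_det_pos[OF Q] .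
  have "((\<lambda>t. det (P t)) \<longlongrightarrow> det Q) ?F" by (intro tendsto_det_entrywise P)
  then have lnP: "((\<lambda>t. ln (det (P t))) \<longlongrightarrow> ln (det Q)) ?F"
    using detQ by (intro tendsto_ln) auto
  have evP: "eventually (\<lambda>t. det (P t) \<noteq> 0) ?F"
    using pos by eventually_elim (use detP in force)
  have w: "((\<lambda>t. w t $ i) \<longlongrightarrow> w 0 $ i) ?F" for i
    using DERIV_isCont[OF w'[of i]] unfolding isCont_def
    by (rule filterlim_mono) (auto intro: at_le)
  then have "(w \<longlongrightarrow> w 0) ?F" by (rule vec_tendstoI)
  then have M: "((\<lambda>t. (M *v w t) \<bullet> w t) \<longlongrightarrow> (M *v w 0) \<bullet> w 0) ?F"
    by (intro tendsto_inner bounded_linear.tendsto[OF matrix_vector_mul_bounded_linear])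
  define G where "G t = (matrix_inv (P t) *v w t) \<bullet> w t" for t
  have G: "(G \<longlongrightarrow> (matrix_inv Q *v w 0) \<bullet> w 0) ?F"
    unfolding G_def using P w detQ evP by (intro tendsto_inverse_form) auto
  have eq: "CARD('n) * ln t + ln (det (P t)) + G t / t - (M *v w t) \<bullet> w t = \<kappa>" if "t > 0" for t
  proof -
    have "(matrix_inv (A t) *v w t) \<bullet> w t = G t / t"
      unfolding AP[OF that] G_def using that by (intro inverse_form_scale invP) auto
    moreover have "ln (det (A t)) = CARD('n) * ln t + ln (det (P t))"
      unfolding detA[OF that] using that detP[OF that] by (simp add: ln_mult ln_realpow)
    ultimately show ?thesis
      using const[OF that] by (simp add: matrix_vector_mult_diff_rdistrib inner_diff_left)
  qed
  show False
  proof (cases "w 0 = 0")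
    case False
    \<comment> \<open>Multiplying the identity \<open>eq\<close> by \<open>t\<close> leaves
      \<open>G t\<close> as the only term that could survive in the limit, so the limit of
      \<open>G\<close> would be 0.\<close>
    have "((\<lambda>t. t * \<kappa> - CARD('n) * (t * ln t) - t * ln (det (P t)) + t * ((M *v w t) \<bullet> w t)) \<longlongrightarrow>
       0 * \<kappa> - real CARD('n) * 0 - 0 * ln (det Q) + 0 * ((M *v w 0) \<bullet> w 0)) ?F"
      by (rule tendsto_add[OF tendsto_diff[OF tendsto_diff[OF tendsto_mult[OF tendsto_ident_at tendsto_const]
              tendsto_mult[OF tendsto_const tendsto_mult_ln_0]] tendsto_mult[OF tendsto_ident_at lnP]]
            tendsto_mult[OF tendsto_ident_at M]])
    moreover have "eventually (\<lambda>t. t * \<kappa> - CARD('n) * (t * ln t) - t * ln (det (P t)) + t * ((M *v w t) \<bullet> w t) = G t) ?F"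
      using pos
    proof eventually_elim
      case (elim t)
      then have "G t = t * (G t / t)" by simp
      then show ?case unfolding eq[OF elim, symmetric] using elim by (simp add: algebra_simps)
    qed
    ultimately have "(G \<longlongrightarrow> 0) ?F" by (auto intro: Lim_transform_eventually)
    then have "(matrix_inv Q *v w 0) \<bullet> w 0 = 0"
      using tendsto_unique[OF _ G] by auto
    then show False using pos_def_inverse_form_pos[OF Q False] by simp
  next
    case True
    \<comment> \<open>The difference quotient of \<open>w\<close>, convergent because
      \<open>w 0 = 0\<close>. By homogeneity \<open>G t / t\<close> is \<open>t\<close> times the
      form of the inverse of \<open>P t\<close> at \<open>v t\<close>, which tends to 0.\<close>
    define v where "v t = (1 / t) *\<^sub>R w t" for t
    have v: "((\<lambda>t. v t $ i) \<longlongrightarrow> w1 $ i) ?F" for i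
      using quot[OF w'[of i]] True by (simp add: v_def)
    have "((\<lambda>t. (matrix_inv (P t) *v v t) \<bullet> v t) \<longlongrightarrow> (matrix_inv Q *v w1) \<bullet> w1) ?F"
      using P v detQ evP by (intro tendsto_inverse_form) auto
    from tendsto_divide[OF tendsto_add[OF tendsto_diff[OF tendsto_diff[OF tendsto_const lnP]
            tendsto_mult[OF tendsto_ident_at this]] M] tendsto_const]
    have "((\<lambda>t. (\<kappa> - ln (det (P t)) - t * ((matrix_inv (P t) *v v t) \<bullet> v t) + (M *v w t) \<bullet> w t) / CARD('n)) \<longlongrightarrow>
       (\<kappa> - ln (det Q) - 0 * ((matrix_inv Q *v w1) \<bullet> w1) + (M *v w 0) \<bullet> w 0) / CARD('n)) ?F"
      by auto
    moreover have "eventually (\<lambda>t. (\<kappa> - ln (det (P t)) - t * ((matrix_inv (P t) *v v t) \<bullet> v t) + (M *v w t) \<bullet> w t) / CARD('n) = ln t) ?F"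
      using pos
    proof eventually_elim
      case (elim t)
      have "t * ((matrix_inv (P t) *v v t) \<bullet> v t) = G t / t"
        using elim by (simp add: v_def G_def matrix_vector_mult_scaleR)
      then show ?case unfolding eq[OF elim, symmetric] by simp
    qed
    ultimately have "((\<lambda>t. ln t) \<longlongrightarrow> (\<kappa> - ln (det Q) - 0 * ((matrix_inv Q *v w1) \<bullet> w1) + (M *v w 0) \<bullet> w 0) / CARD('n)) ?F"
      by (rule Lim_transform_eventually)
    then show False
      using not_tendsto_and_filterlim_at_infinity[OF _ _ filterlim_at_bot_imp_at_infinity[OF ln_at_0]] by auto
  qed
qed

section \<open>The kernel as a quotient of functions in a fixed finite-dimensional space\<close>

lemma sum_fun: "(\<Sum>i\<in>I. f i) = (\<lambda>t. \<Sum>i\<in>I. f i t)"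
  for f :: "'i \<Rightarrow> 'a \<Rightarrow> 'b::comm_monoid_add"
  by (induction I rule: infinite_finite_induct) (auto simp: fun_eq_iff)

lemma span_pointwise_sum:
  assumes "\<And>i. i \<in> I \<Longrightarrow> f i \<in> fs.span S"
  shows "(\<lambda>t. \<Sum>i\<in>I. f i t) \<in> fs.span S"
  using fs.span_sum[of I f S] assms unfolding sum_fun by blast

lemma span_pointwise_add:
  "f \<in> fs.span S \<Longrightarrow> g \<in> fs.span S \<Longrightarrow> (\<lambda>t. f t + g t) \<in> fs.span S"
  using fs.span_add unfolding plus_fun_def by blast

lemma span_pointwise_diff:
  assumes "f \<in> fs.span S" "g \<in> fs.span S"
  shows "(\<lambda>t. f t - g t) \<in> fs.span S"
proof -
  have "f - g = (\<lambda>t. f t - g t)" unfolding fun_diff_def ..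
  then show ?thesis using fs.span_diff[OF assms] by (simp only:)
qed

lemma span_pointwise_const:
  assumes "1 \<in> S"
  shows "(\<lambda>t. c) \<in> fs.span S"
  using fs.span_scale[OF fs.span_base[OF assms], of c] by (simp add: one_fun_def)

lemma span_power_mono:
  assumes "1 \<in> S" "a \<le> b" "f \<in> fs.span (S ^ a)"
  shows "f \<in> fs.span (S ^ b)"
  using fs.span_mono[OF power_set_mono[OF assms(1,2)]] assms(3) by blast

lemma span_power_mult:
  assumes "f \<in> fs.span (S ^ a)" "g \<in> fs.span (S ^ b)"
  shows "(\<lambda>t. f t * g t) \<in> fs.span (S ^ (a + b))"
  using span_mult[OF assms] unfolding power_add times_fun_def .

lemma span_power_prod:
  fixes f :: "'i \<Rightarrow> 'a \<Rightarrow> real"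
  assumes "\<And>i. i \<in> I \<Longrightarrow> f i \<in> fs.span S" "finite I"
  shows "(\<lambda>t. \<Prod>i\<in>I. f i t) \<in> fs.span (S ^ card I)"
  using assms(2,1)
proof (induction I)
  case empty
  have "(\<lambda>t. 1) \<in> fs.span (1 :: ('a \<Rightarrow> real) set)"
    by (rule span_pointwise_const) simp
  then show ?case by simp
next
  case (insert i I)
  have "f i \<in> fs.span (S ^ 1)" unfolding power_one_right using insert by blast
  then have "(\<lambda>t. f i t * (\<Prod>i\<in>I. f i t)) \<in> fs.span (S ^ (1 + card I))"
    using insert by (intro span_power_mult) auto
  then show ?case using insert by simp
qed

lemma span_det:
  fixes A :: "'a \<Rightarrow> real^'n^'n"
  assumes "\<And>i j. (\<lambda>t. A t $ i $ j) \<in> fs.span S"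
  shows "(\<lambda>t. det (A t)) \<in> fs.span (S ^ CARD('n))"
  unfolding det_def by (intro span_pointwise_sum fs.span_scale span_power_prod assms finite)

text \<open>The antiderivative is wanted on the whole line, since \<open>deriv_closed\<close> asks
  for derivatives at every real \<open>t\<close>.\<close>

lemma continuous_has_antiderivative:
  fixes f :: "real \<Rightarrow> real"
  assumes "\<And>x. isCont f x"
  shows "\<exists>F. \<forall>x. (F has_real_derivative f x) (at x)"
  using einterval_antiderivative[of "-\<infinity>" "\<infinity>" f] assms
  by (auto simp: has_real_derivative_iff_has_vector_derivative)

text \<open>The covariance matrices are built from the entries of \<open>exp (t B)\<close> and
  \<open>exp (- t B\<^sup>*)\<close> and from antiderivatives of products of such entries; none of these functions
  depends on \<open>Q\<close>.\<close>

lemma exists_deriv_closed_generators: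
  fixes B :: "real^'n^'n"
  shows "\<exists>S F. finite S \<and> 1 \<in> S \<and> deriv_closed S \<and>
    (\<forall>i j. (\<lambda>t. matrix_exp ((- t) *\<^sub>R transpose B) $ i $ j) \<in> S) \<and>
    (\<forall>i j k l. F i j k l \<in> S \<and> (\<forall>t. (F i j k l has_real_derivative
      matrix_exp (t *\<^sub>R B) $ i $ l * matrix_exp (t *\<^sub>R transpose B) $ k $ j) (at t)))"
proof -
  define e where "e A = (\<lambda>(i, j) t. matrix_exp (t *\<^sub>R A) $ i $ j)" for A :: "real^'n^'n"
  define P where "P = (\<lambda>(p, q) t. e B p t * e (transpose B) q t)"
  have e': "(e A (i, j) has_real_derivative (\<Sum>k\<in>UNIV. A $ i $ k * e A (k, j) t)) (at t)" for A i j t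
    using matrix_exp_entry_has_derivative[of A i j t] by (simp add: e_def matrix_matrix_mult_def)
  have P': "(P ((i, l), (k, j)) has_real_derivative
     (\<Sum>m\<in>UNIV. B $ i $ m * P ((m, l), (k, j)) t) + (\<Sum>m\<in>UNIV. transpose B $ k $ m * P ((i, l), (m, j)) t)) (at t)" for i j k l t
    unfolding P_def prod.case
    by (rule derivative_eq_intros e' refl)+ (simp add: sum_distrib_left sum_distrib_right ac_simps)
  define F where "F i j k l = (SOME F. \<forall>t. (F has_real_derivative P ((i, l), (k, j)) t) (at t))" for i j k l
  have F: "(F i j k l has_real_derivative P ((i, l), (k, j)) t) (at t)" for i j k l t
  proof -
    have "\<exists>F. \<forall>t. (F has_real_derivative P ((i, l), (k, j)) t) (at t)"
      by (intro continuous_has_antiderivative) (blast intro: DERIV_isCont P')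
    then show ?thesis unfolding F_def by (rule someI2_ex) blast
  qed
  \<comment> \<open>The family \<open>P\<close> is closed by itself: differentiating a factor
    multiplies it from the left by \<open>B\<close> or its transpose. The functions \<open>F\<close>
    have derivatives in \<open>P\<close>, and 1 supplies the constants.\<close>
  define S where "S = {1} \<union> range (e (- transpose B)) \<union> range P \<union> range (\<lambda>(i, j, k, l). F i j k l)"
  have S: "e (- transpose B) p \<in> S" "P q \<in> S" "F i j k l \<in> S" for p q i j k l
    unfolding S_def by (auto intro!: image_eqI[of _ _ "(i, j, k, l)"])
  have lin: "(\<lambda>t. \<Sum>m\<in>UNIV. c m * f m t) \<in> fs.span S" if "\<And>m. f m \<in> S"
    for c :: "'n \<Rightarrow> real" and f
    by (intro span_pointwise_sum fs.span_scale fs.span_base that)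
  have "\<exists>h\<in>fs.span S. \<forall>t. (g has_real_derivative h t) (at t)" if "g \<in> S" for g
  proof -
    have "g = 1 \<or> (\<exists>i j. g = e (- transpose B) (i, j)) \<or> (\<exists>i l k j. g = P ((i, l), (k, j))) \<or>
        (\<exists>i j k l. g = F i j k l)"
      using that by (simp add: S_def image_iff)
    then consider "g = 1" | i j where "g = e (- transpose B) (i, j)" | i j k l where "g = P ((i, l), (k, j))"
      | i j k l where "g = F i j k l"
      by (elim disjE exE) simp_all
    then show ?thesis
    proof cases
      case 1
      then show ?thesis by (intro bexI[of _ 0] fs.span_zero) (simp add: one_fun_def zero_fun_def)
    next
      case 2
      show ?thesis unfolding 2
        by (intro bexI[of _ "\<lambda>t. \<Sum>k\<in>UNIV. (- transpose B) $ i $ k * e (- transpose B) (k, j) t"] allI e' lin S)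
    next
      case 3
      show ?thesis unfolding 3
        by (intro bexI[of _ "\<lambda>t. (\<Sum>m\<in>UNIV. B $ i $ m * P ((m, l), (k, j)) t) + (\<Sum>m\<in>UNIV. transpose B $ k $ m * P ((i, l), (m, j)) t)"]
            allI P' span_pointwise_add lin S)
    next
      case 4
      show ?thesis unfolding 4
        by (intro bexI[of _ "P ((i, l), (k, j))"] allI F fs.span_base S)
    qed
  qed
  then have dc: "deriv_closed S" unfolding deriv_closed_def by blast
  have fin: "finite S" "1 \<in> S" unfolding S_def by (auto intro!: finite_imageI)
  have exp_mem: "(\<lambda>t. matrix_exp ((- t) *\<^sub>R transpose B) $ i $ j) \<in> S" for i j
    using S(1)[of "(i, j)"] by (simp add: e_def)
  have F': "(F i j k l has_real_derivative
      matrix_exp (t *\<^sub>R B) $ i $ l * matrix_exp (t *\<^sub>R transpose B) $ k $ j) (at t)" for i j k l t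
    using F[of i j k l t] by (simp add: P_def e_def)
  show ?thesis
    by (rule exI[of _ S], rule exI[of _ F]) (intro conjI allI fin dc exp_mem F' S(3))
qed

theorem proposition9p1:
  fixes B :: "real^'n^'n"
  assumes "\<And>z. complex_eigenvalue B z \<Longrightarrow> Re z < 0"
  shows "\<exists>N::nat. N > 0 \<and>
    (\<forall>Q :: real^'n^'n. sym_pos_def Q \<longrightarrow>
      (\<forall>x u :: real^'n.
         finite {t \<in> {0<..1}. deriv (\<lambda>s. mehler_kernel B Q s x u) t = 0} \<and>
         card {t \<in> {0<..1}. deriv (\<lambda>s. mehler_kernel B Q s x u) t = 0} \<le> N))"
proof -
  obtain S F where S: "finite S" "1 \<in> S" "deriv_closed S"
    and gen: "\<forall>i j. (\<lambda>t. matrix_exp ((- t) *\<^sub>R transpose B) $ i $ j) \<in> S"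
      "\<forall>i j k l. F i j k l \<in> S \<and> (\<forall>t. (F i j k l has_real_derivative
        matrix_exp (t *\<^sub>R B) $ i $ l * matrix_exp (t *\<^sub>R transpose B) $ k $ j) (at t))"
    using exists_deriv_closed_generators[of B] by (elim exE conjE) (rule that; assumption)
  have eS: "(\<lambda>t. matrix_exp ((- t) *\<^sub>R transpose B) $ i $ j) \<in> S" for i j
    using gen(1) by blast
  have FS: "F i j k l \<in> S" for i j k l
    using gen(2) by blast
  have F': "(F i j k l has_real_derivative
      matrix_exp (t *\<^sub>R B) $ i $ l * matrix_exp (t *\<^sub>R transpose B) $ k $ j) (at t)" for i j k l t
    using gen(2) by blast
  \<comment> \<open>Degrees in the generators: \<open>d\<close> has degree n, the Cramer form n + 1,
    and \<open>d\<close> times a quadratic form in \<open>w\<close> has n + 2. Each term of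
    \<open>f\<close> is a product of two functions of degree at most \<open>m\<close>, whence
    \<open>m + m\<close>. The number \<open>N\<close> is fixed before \<open>Q\<close>,
    \<open>x\<close> and \<open>u\<close>.\<close>
  define m where "m = CARD('n) + 2"
  obtain N where N: "\<forall>f\<in>fs.span (S ^ (m + m)). \<forall>t. f t \<noteq> 0 \<longrightarrow>
      finite {z\<in>{0..1}. f z = 0} \<and> card {z\<in>{0..1}. f z = 0} \<le> N"
    using span_zeros_uniformly_bounded[OF finite_power_set[OF S(1)] deriv_closed_power[OF S(3)]] ..
  have "finite {t \<in> {0<..1}. deriv (\<lambda>s. mehler_kernel B Q s x u) t = 0} \<and>
      card {t \<in> {0<..1}. deriv (\<lambda>s. mehler_kernel B Q s x u) t = 0} \<le> Suc N"
    if "sym_pos_def Q" for Q :: "real^'n^'n" and x u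
  proof -
    have Q: "pos_def Q" using that by (simp add: sym_pos_def_def pos_def_def)
    define R where "R = Qcov B Q \<infinity>"
    define M where "M = matrix_inv R"
    \<comment> \<open>\<open>Qcov\<close> is 0 for negative \<open>t\<close>. This formula agrees
      with it for \<open>t \<ge> 0\<close> but is differentiable through 0 and lies entrywise in the
      span.\<close>
    define A :: "real \<Rightarrow> real^'n^'n" where
      "A t = (\<chi> i j. \<Sum>k\<in>UNIV. \<Sum>l\<in>UNIV. Q $ l $ k * (F i j k l t - F i j k l 0))" for t
    \<comment> \<open>At \<open>t = 0\<close> this is \<open>u - x\<close>, so the degenerate case
      of the analysis near 0 is \<open>u = x\<close>.\<close>
    define w where "w t = u - Dmat B Q t *v x" for t
    define d where "d t = det (A t)" for t
    define n where "n t = cramer_form (A t) (w t) - d t * ((M *v w t) \<bullet> w t)" for t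
    have R: "pos_def R" unfolding R_def by (rule pos_def_Qcov[OF assms Q]) (simp_all add: zero_ereal_def)
    have A_eq: "Qcov B Q (ereal t) = A t" if "t \<ge> 0" for t
      using Qcov_entry[OF assms Q F' that] by (simp add: A_def vec_eq_iff)
    have dpos: "d t > 0" if "t > 0" for t
    proof -
      have "pos_def (Qcov B Q (ereal t))"
        by (rule pos_def_Qcov[OF assms Q]) (use that in simp_all)
      then show ?thesis using that by (simp add: d_def A_eq pos_def_det_pos)
    qed
    have AS: "(\<lambda>t. A t $ i $ j) \<in> fs.span S" for i j
      unfolding A_def vec_lambda_beta
      by (intro span_pointwise_sum fs.span_scale span_pointwise_diff span_pointwise_const S fs.span_base FS)
    have wS: "(\<lambda>t. w t $ i) \<in> fs.span S" for i
    proof -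
      \<comment> \<open>\<open>R\<close> and \<open>M\<close> depend on \<open>Q\<close>, but appear
        only as constant coefficients and add no new functions of \<open>t\<close>.\<close>
      have "w t $ i = u $ i - (\<Sum>j\<in>UNIV. x $ j * (\<Sum>k\<in>UNIV. M $ k $ j * (\<Sum>l\<in>UNIV. R $ i $ l * matrix_exp ((- t) *\<^sub>R transpose B) $ l $ k)))" for t
        unfolding w_def Dmat_def R_def[symmetric] M_def[symmetric]
        by (simp add: matrix_vector_mult_def matrix_matrix_mult_def mult.commute)
      then show ?thesis
        by (simp only:) (intro span_pointwise_diff span_pointwise_sum fs.span_scale span_pointwise_const S fs.span_base eS)
    qed
    have dS: "d \<in> fs.span (S ^ CARD('n))"
      using span_det[OF AS] unfolding d_def .
    have nS: "n \<in> fs.span (S ^ m)"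
    proof -
      have w1: "(\<lambda>t. w t $ i) \<in> fs.span (S ^ 1)" for i unfolding power_one_right by (rule wS)
      have "(\<lambda>t. if j = k then w t $ i else A t $ i $ j) \<in> fs.span S" for i j k
        using wS AS by (cases "j = k") auto
      then have "(\<lambda>t. det (\<chi> i j. if j = k then w t $ i else A t $ i $ j)) \<in> fs.span (S ^ CARD('n))" for k
        by (intro span_det) simp
      from span_power_mono[OF S(2) _ span_power_mult[OF this w1], where b=m]
      have 1: "(\<lambda>t. cramer_form (A t) (w t)) \<in> fs.span (S ^ m)"
        unfolding cramer_form_def by (intro span_pointwise_sum) (simp add: m_def)
      have "(\<lambda>t. (M *v w t) \<bullet> w t) = (\<lambda>t. \<Sum>i\<in>UNIV. \<Sum>j\<in>UNIV. M $ i $ j * (w t $ j * w t $ i))"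
        unfolding inner_vec_def matrix_vector_mult_def vec_lambda_beta inner_real_def sum_distrib_right mult.assoc ..
      also have "\<dots> \<in> fs.span (S ^ (1 + 1))"
        by (intro span_pointwise_sum fs.span_scale span_power_mult w1)
      finally have "(\<lambda>t. d t * ((M *v w t) \<bullet> w t)) \<in> fs.span (S ^ (CARD('n) + (1 + 1)))"
        by (intro span_power_mult dS)
      then show ?thesis unfolding n_def using 1 by (intro span_pointwise_diff) (simp_all add: m_def)
    qed
    have dm: "d \<in> fs.span (S ^ m)"
      by (rule span_power_mono[OF S(2) _ dS]) (simp add: m_def)
    note Sm = deriv_closed_power[OF S(3), of m]
    \<comment> \<open>For positive \<open>t\<close> this is the square of \<open>d\<close> times the
      derivative of \<open>\<phi>\<close> below.\<close>
    define f where "f t = deriv d t * d t + (deriv n t * d t - n t * deriv d t)" for t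
    have fS: "f \<in> fs.span (S ^ (m + m))"
      unfolding f_def
      by (intro span_pointwise_add span_pointwise_diff span_power_mult span_deriv(1) Sm dm nS)
    define \<phi> where "\<phi> t = ln (d t) + n t / d t" for t
    have \<phi>': "(\<phi> has_real_derivative f t / (d t)\<^sup>2) (at t)" if "t > 0" for t
      unfolding \<phi>_def f_def using dpos[OF that]
      by (auto intro!: derivative_eq_intros span_deriv(2)[OF Sm dm] span_deriv(2)[OF Sm nS]
          simp: field_simps power2_eq_square)
    have \<phi>_eq: "\<phi> t = ln (det (A t)) + ((matrix_inv (A t) - M) *v w t) \<bullet> w t" if "t > 0" for t
      using dpos[OF that] unfolding \<phi>_def n_def d_def
      by (simp add: matrix_vector_mult_diff_rdistrib inner_diff_left inverse_form_eq_cramer diff_divide_distrib)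
    define c where "c = sqrt (det R) * exp (Rquad B Q x)"
    have c: "c > 0" using pos_def_det_pos[OF R] by (simp add: c_def)
    have K: "mehler_kernel B Q t x u = c * exp (- \<phi> t / 2)" if "t > 0" for t
    proof -
      have "sqrt (d t) = exp (ln (d t) / 2)"
        using dpos[OF that] by (intro real_sqrt_unique) (simp_all add: power2_eq_square exp_add[symmetric])
      then have "sqrt (det R / d t) = sqrt (det R) * exp (- ln (d t) / 2)"
        by (simp add: real_sqrt_divide exp_minus field_simps)
      then show ?thesis
        unfolding mehler_kernel_def \<phi>_eq[OF that] A_eq[OF less_imp_le[OF that]] w_def[symmetric] M_def[symmetric]
          R_def[symmetric] c_def d_def
        by (simp add: add_divide_distrib mult_ac flip: exp_add)
    qed
    have K': "deriv (\<lambda>s. mehler_kernel B Q s x u) t = - c * exp (- \<phi> t / 2) * (f t / (d t)\<^sup>2) / 2"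
      if "t > 0" for t
    proof (rule DERIV_imp_deriv)
      have "((\<lambda>s. c * exp (- \<phi> s / 2)) has_real_derivative - c * exp (- \<phi> t / 2) * (f t / (d t)\<^sup>2) / 2) (at t)"
        by (auto intro!: derivative_eq_intros \<phi>' that simp: ac_simps)
      then show "((\<lambda>s. mehler_kernel B Q s x u) has_real_derivative - c * exp (- \<phi> t / 2) * (f t / (d t)\<^sup>2) / 2) (at t)"
        by (rule has_field_derivative_transform_within_open[where S="{0<..}"]) (use that K in auto)
    qed
    have sub: "{t \<in> {0<..1}. deriv (\<lambda>s. mehler_kernel B Q s x u) t = 0} \<subseteq> {z\<in>{0..1}. f z = 0}"
    proof (clarsimp, goal_cases)
      case (1 t)
      then show ?case using K'[of t] c dpos[of t] by simp
    qed
    have "\<exists>t. f t \<noteq> 0"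
    proof (rule ccontr)
      assume "\<not> (\<exists>t. f t \<noteq> 0)"
      then have \<phi>0: "(\<phi> has_real_derivative 0) (at t)" if "t > 0" for t
        using \<phi>'[OF that] by simp
      \<comment> \<open>The open interval from 0 to \<open>t + 2\<close> contains both
        \<open>t\<close> and 1.\<close>
      have const: "\<phi> t = \<phi> 1" if "t > 0" for t
        by (rule DERIV_isconst3[of 0 "t + 1 + 1"]) (use \<phi>0 that in auto)
      define w1 :: "real^'n" where "w1 = (\<chi> i. deriv (\<lambda>t. w t $ i) 0)"
      show False
      proof (rule phase_not_constant[of A Q w w1 M "\<phi> 1"])
        fix i j
        \<comment> \<open>At time 0 both exponentials are the identity, so the derivative of
          \<open>A\<close> there is \<open>Q\<close> itself.\<close>
        have "(\<Sum>l\<in>UNIV. Q $ l $ k * (mat 1 $ i $ l * mat 1 $ k $ j)) = (if k = j then Q $ i $ k else 0)" for k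
          by (cases "k = j") (simp_all add: mat_def if_distrib[of "\<lambda>x. _ * x"] cong: if_cong)
        then have sum1: "(\<Sum>k\<in>UNIV. \<Sum>l\<in>UNIV. Q $ l $ k * (mat 1 $ i $ l * mat 1 $ k $ j)) = Q $ i $ j"
          by simp
        have "((\<lambda>t. A t $ i $ j) has_real_derivative (\<Sum>k\<in>UNIV. \<Sum>l\<in>UNIV. Q $ l $ k *
            ((matrix_exp (0 *\<^sub>R B) $ i $ l * matrix_exp (0 *\<^sub>R transpose B) $ k $ j) - 0))) (at 0)"
          unfolding A_def vec_lambda_beta by (intro DERIV_sum DERIV_cmult DERIV_diff F' DERIV_const)
        then show "((\<lambda>t. A t $ i $ j) has_real_derivative Q $ i $ j) (at 0)"
          using sum1 by simp
      next
        fix i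
        show "((\<lambda>t. w t $ i) has_real_derivative w1 $ i) (at 0)"
          unfolding w1_def vec_lambda_beta by (rule span_deriv(2)[OF S(3) wS])
      next
        show "A 0 = 0" by (simp add: A_def vec_eq_iff)
      next
        fix t :: real assume "t > 0"
        then show "det (A t) > 0" "ln (det (A t)) + ((matrix_inv (A t) - M) *v w t) \<bullet> w t = \<phi> 1"
          using dpos[of t] const[of t] \<phi>_eq[of t] by (simp_all add: d_def)
      qed (rule Q)
    qed
    then obtain t0 where "f t0 \<noteq> 0" ..
    then have "finite {z\<in>{0..1}. f z = 0}" "card {z\<in>{0..1}. f z = 0} \<le> N"
      using N fS by auto
    then show ?thesis
      using sub by (meson card_mono finite_subset le_SucI le_trans)
  qed
  \<comment> \<open>The successor makes the bound positive even when \<open>N\<close> is 0.\<close>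
  then show ?thesis by (intro exI[of _ "Suc N"]) blast
qed

end
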